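(* Suppose $\lim_{\eta\uparrow\infty}\epsilon_\eta\tau_\eta=l\in(0,\infty)$ and $\lambda^\star_\eta=\lambda^\star$ for all $\eta>0$, where $\lambda^\star=\mu^\star$. Suppose the control curves $\phi^c,\phi^s$ satisfy the following three conditions. (Negative Drift) There exist $\delta,K,B>0$ such that $\phi^c(x)-\phi^s(x)<-\delta$ and $[\phi^c(x)]^++[\phi^s(x)]^-\le B$ for all $x>K$, and $\phi^c(x)-\phi^s(x)>\delta$ and $[\phi^c(x)]^-+[\phi^s(x)]^+\le B$ for all $x<-K$. (sub-Quadratic Growth) There exists $\beta\in(0,2)$ such that $|\phi^c(x)|\le|x|^\beta$ and $|\phi^s(x)|\le|x|^\beta$ for all $x\in\mathbb{R}$. (Smoothness) $\phi^c$ and $\phi^s$ are infinitely differentiable on $\mathbb{R}$. Let $\eta_p>0$ be such that the imbalance DTMC $\{z_\eta(k):k\in\mathbb{Z}_+\}$ is positive recurrent for every $\eta>\eta_p$, and let $\bar z_\eta$ denote its steady-state random variable. Then, as $\eta\uparrow\infty$, $$\epsilon_\eta\bar z_\eta\overset{D}{\longrightarrow}\operatorname{Gibbs}(g_{1,l}),\qquad \frac{\bar z_\eta}{\tau_\eta}\overset{D}{\longrightarrow}\operatorname{Gibbs}(g_{l,1}),$$ where, for $x>0$, $y>0$ and $t\in\mathbb{R}$, $$g_{x,y}(t)=\frac{2x}{\sigma^c(\lambda^\star)+\sigma^s(\mu^\star)}\left(\phi^s\!\left(\frac{t}{y}\right)-\phi^c\!\left(\frac{t}{y}\right)\right).$$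
   Context: Notation: $\mathbb{Z}_+$ is the set of non-negative integers; $[x]^+=\max\{x,0\}$, $[x]^-=\max\{-x,0\}$; $\operatorname{clip}(x,x_{\max},x_{\min})=\max\{\min\{x,x_{\max}\},x_{\min}\}$; $\overset{D}{\to}$ is convergence in distribution. Model (matching queue). Fix constants $\lambda_{\max}\ge\lambda_{\min}\ge0$, $\mu_{\max}\ge\mu_{\min}\ge0$, $\sigma_{\max}>0$, $M>0$ and $\mu^\star$ with $\lambda_{\min}<\mu^\star<\lambda_{\max}$ and $\mu_{\min}<\mu^\star<\mu_{\max}$; continuous functions $\sigma^c,\sigma^s:\mathbb{R}\to[0,\sigma_{\max}]$; and Borel measurable control curves $\phi^c,\phi^s:\mathbb{R}\to\mathbb{R}$. For each $\eta>0$ let $\epsilon_\eta>0$, $\tau_\eta>0$, $\lambda^\star_\eta\in\mathbb{R}$, and for $z\in\mathbb{Z}$ put $$\lambda_\eta(z)=\operatorname{clip}\!\left(\lambda^\star_\eta+\epsilon_\eta\phi^c(z/\tau_\eta),\lambda_{\max},\lambda_{\min}\right),\quad \mu_\eta(z)=\operatorname{clip}\!\left(\mu^\star+\epsilon_\eta\phi^s(z/\tau_\eta),\mu_{\max},\mu_{\min}\right).$$ For each $\eta>0$ the random variables $a^c_\eta(z,k),a^s_\eta(z,k)$ ($z\in\mathbb{Z},k\in\mathbb{Z}_+$) are $\mathbb{Z}_+$-valued and mutually independent; for each $z$, the $a^c_\eta(z,k)$, $k\in\mathbb{Z}_+$, are identically distributed with generic copy $a^c_\eta(z)$, and similarly for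 $a^s_\eta(z)$. They satisfy $E[a^c_\eta(z)]=\lambda_\eta(z)$, $E[a^s_\eta(z)]=\mu_\eta(z)$, $\operatorname{Var}[a^c_\eta(z)]=\sigma^c(\lambda_\eta(z))$, $\operatorname{Var}[a^s_\eta(z)]=\sigma^s(\mu_\eta(z))$, $E[|a^c_\eta(z)|^3]\le M$, $E[|a^s_\eta(z)|^3]\le M$. The imbalance is the DTMC on $\mathbb{Z}$ with $z_\eta(0)=0$ and $z_\eta(k+1)=z_\eta(k)+a^c_\eta(z_\eta(k),k)-a^s_\eta(z_\eta(k),k)$. The arrival distributions are assumed such that this DTMC is irreducible on $\mathbb{Z}$ and aperiodic. When it is positive recurrent, $\bar z_\eta$ is a random variable with its unique stationary distribution. Asymptotic regime: as $\eta\uparrow\infty$, $\epsilon_\eta\to0$ and/or $\tau_\eta\to\infty$ (at least one holds). It is presupposed that $\sigma^c(\lambda^\star)+\sigma^s(\mu^\star)>0$, so that $g_{x,y}$ is defined. $\operatorname{Gibbs}(g)$, for $g:\mathbb{R}\to\mathbb{R}$ with $\int_{-\infty}^\infty e^{-\int_0^xg(y)dy}dx<\infty$, is the distribution with density $x\mapsto e^{-\int_0^xg(y)dy}\big/\int_{-\infty}^\infty e^{-\int_0^ug(y)dy}du$, where $\int_0^x g=-\int_x^0g$ for $x<0$. *)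

theory Defs
  imports "HOL-Probability.Probability"
begin

section \<open>Markov chain notions\<close>

text \<open>
  A time-homogeneous chain is given by a family of processes on one probability space:
  X i n is the state at time n of the copy started in i. Hence
  trans_prob P X n i j is the n-step transition probability from i to j.
\<close>

definition trans_prob :: "'w measure \<Rightarrow> ('s \<Rightarrow> nat \<Rightarrow> 'w \<Rightarrow> 's) \<Rightarrow> nat \<Rightarrow> 's \<Rightarrow> 's \<Rightarrow> real" where
  "trans_prob P X n i j = measure P {w \<in> space P. X i n w = j}"

definition irreducible_chain :: "'w measure \<Rightarrow> ('s \<Rightarrow> nat \<Rightarrow> 'w \<Rightarrow> 's) \<Rightarrow> bool" where
  "irreducible_chain P X \<longleftrightarrow> (\<forall>i j. \<exists>n. trans_prob P X n i j > 0)"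

definition aperiodic_chain :: "'w measure \<Rightarrow> ('s \<Rightarrow> nat \<Rightarrow> 'w \<Rightarrow> 's) \<Rightarrow> bool" where
  "aperiodic_chain P X \<longleftrightarrow> (\<forall>i. Gcd {n. 0 < n \<and> trans_prob P X n i i > 0} = 1)"

text \<open>The infimum of the empty set is infinity in the extended naturals.\<close>

definition return_time :: "('s \<Rightarrow> nat \<Rightarrow> 'w \<Rightarrow> 's) \<Rightarrow> 's \<Rightarrow> 'w \<Rightarrow> enat" where
  "return_time X i w = Inf (enat ` {n. 0 < n \<and> X i n w = i})"

definition positive_recurrent_chain :: "'w measure \<Rightarrow> ('s \<Rightarrow> nat \<Rightarrow> 'w \<Rightarrow> 's) \<Rightarrow> bool" where
  "positive_recurrent_chain P X \<longleftrightarrow>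
     (\<forall>i. (\<integral>\<^sup>+w. ennreal_of_enat (return_time X i w) \<partial>P) < \<infinity>)"

definition stationary_distribution ::
    "'w measure \<Rightarrow> ('s \<Rightarrow> nat \<Rightarrow> 'w \<Rightarrow> 's) \<Rightarrow> 's measure \<Rightarrow> bool" where
  "stationary_distribution P X D \<longleftrightarrow>
     prob_space D \<and> sets D = sets (count_space UNIV) \<and>
     (\<forall>j. ((\<lambda>i. measure D {i} * trans_prob P X 1 i j) has_sum measure D {j}) UNIV)"

section \<open>The matching queue\<close>

definition clip :: "real \<Rightarrow> real \<Rightarrow> real \<Rightarrow> real" where
  "clip x xmax xmin = max (min x xmax) xmin"

definition controlled_rate ::
    "real \<Rightarrow> real \<Rightarrow> real \<Rightarrow> (real \<Rightarrow> real) \<Rightarrow> real \<Rightarrow> real \<Rightarrow> int \<Rightarrow> real" where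
  "controlled_rate base eps tau phi rmax rmin z =
     clip (base + eps * phi (of_int z / tau)) rmax rmin"

primrec imbalance ::
    "(int \<Rightarrow> nat \<Rightarrow> 'w \<Rightarrow> nat) \<Rightarrow> (int \<Rightarrow> nat \<Rightarrow> 'w \<Rightarrow> nat) \<Rightarrow> int \<Rightarrow> nat \<Rightarrow> 'w \<Rightarrow> int" where
  "imbalance arrc arrs i 0 w = i"
| "imbalance arrc arrs i (Suc k) w =
     imbalance arrc arrs i k w
       + int (arrc (imbalance arrc arrs i k w) k w)
       - int (arrs (imbalance arrc arrs i k w) k w)"

text \<open>
  The queue for one fixed value of the scaling parameter. lam and mu are the
  state-dependent rates; sigc and sigs give the variance as a function of the rate.
  Integrability of the third powers makes all the expectations below genuine.
\<close>

locale matching_queue = prob_space P for P :: "'w measure" +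
  fixes arrc arrs :: "int \<Rightarrow> nat \<Rightarrow> 'w \<Rightarrow> nat"
    and lam mu :: "int \<Rightarrow> real"
    and sigc sigs :: "real \<Rightarrow> real"
    and M :: real
  assumes independent:
      "indep_vars (\<lambda>_. count_space UNIV)
         (case_sum (\<lambda>(z, k). arrc z k) (\<lambda>(z, k). arrs z k)) UNIV"
    and identical_c:
      "distr P (count_space UNIV) (arrc z k) = distr P (count_space UNIV) (arrc z k')"
    and identical_s:
      "distr P (count_space UNIV) (arrs z k) = distr P (count_space UNIV) (arrs z k')"
    and mean_c: "expectation (\<lambda>w. real (arrc z k w)) = lam z"
    and mean_s: "expectation (\<lambda>w. real (arrs z k w)) = mu z"
    and variance_c: "variance (\<lambda>w. real (arrc z k w)) = sigc (lam z)"
    and variance_s: "variance (\<lambda>w. real (arrs z k w)) = sigs (mu z)"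
    and third_integrable_c: "integrable P (\<lambda>w. real (arrc z k w) ^ 3)"
    and third_integrable_s: "integrable P (\<lambda>w. real (arrs z k w) ^ 3)"
    and third_moment_c: "expectation (\<lambda>w. real (arrc z k w) ^ 3) \<le> M"
    and third_moment_s: "expectation (\<lambda>w. real (arrs z k w) ^ 3) \<le> M"
    and irreducible: "irreducible_chain P (imbalance arrc arrs)"
    and aperiodic: "aperiodic_chain P (imbalance arrc arrs)"

section \<open>Conditions on the control curves\<close>

definition negative_drift :: "(real \<Rightarrow> real) \<Rightarrow> (real \<Rightarrow> real) \<Rightarrow> bool" where
  "negative_drift phic phis \<longleftrightarrow>
     (\<exists>\<delta> K B. \<delta> > 0 \<and> K > 0 \<and> B > 0 \<and>
        (\<forall>x>K. phic x - phis x < - \<delta> \<and> max (phic x) 0 + max (- phis x) 0 \<le> B) \<and>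
        (\<forall>x<(- K). phic x - phis x > \<delta> \<and> max (- phic x) 0 + max (phis x) 0 \<le> B))"

definition subquadratic_growth :: "(real \<Rightarrow> real) \<Rightarrow> (real \<Rightarrow> real) \<Rightarrow> bool" where
  "subquadratic_growth phic phis \<longleftrightarrow>
     (\<exists>\<beta>. 0 < \<beta> \<and> \<beta> < 2 \<and>
        (\<forall>x. \<bar>phic x\<bar> \<le> \<bar>x\<bar> powr \<beta> \<and> \<bar>phis x\<bar> \<le> \<bar>x\<bar> powr \<beta>))"

definition infinitely_differentiable :: "(real \<Rightarrow> real) \<Rightarrow> bool" where
  "infinitely_differentiable f \<longleftrightarrow> (\<forall>n. (deriv ^^ n) f differentiable_on UNIV)"

section \<open>Gibbs distributions and convergence in distribution\<close>

text \<open>The interval integral is oriented: it changes sign when x is negative.\<close>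

definition gibbs_weight :: "(real \<Rightarrow> real) \<Rightarrow> real \<Rightarrow> real" where
  "gibbs_weight g x = exp (- (LBINT y=ereal 0..ereal x. g y))"

definition gibbs_normalizable :: "(real \<Rightarrow> real) \<Rightarrow> bool" where
  "gibbs_normalizable g \<longleftrightarrow> integrable lborel (gibbs_weight g)"

definition Gibbs :: "(real \<Rightarrow> real) \<Rightarrow> real measure" where
  "Gibbs g =
     density lborel (\<lambda>x. ennreal (gibbs_weight g x / (LINT u|lborel. gibbs_weight g u)))"

definition gibbs_drift ::
    "real \<Rightarrow> (real \<Rightarrow> real) \<Rightarrow> (real \<Rightarrow> real) \<Rightarrow> real \<Rightarrow> real \<Rightarrow> real \<Rightarrow> real" where
  "gibbs_drift v phic phis x y t = 2 * x / v * (phis (t / y) - phic (t / y))"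

text \<open>The library's weak convergence covers sequences only; here the index runs along a filter.\<close>

definition weak_conv_along :: "'i filter \<Rightarrow> ('i \<Rightarrow> real measure) \<Rightarrow> real measure \<Rightarrow> bool" where
  "weak_conv_along F D D' \<longleftrightarrow>
     (\<forall>x. isCont (cdf D') x \<longrightarrow> ((\<lambda>i. cdf (D i) x) \<longlongrightarrow> cdf D' x) F)"

lemma weak_conv_along_sequentially: "weak_conv_along sequentially D D' \<longleftrightarrow> weak_conv_m D D'"
  by (simp add: weak_conv_along_def weak_conv_m_def weak_conv_def)

end

theory Submission
  imports Defs
begin

text \<open>
  Consider the imbalance at a scale \<open>s\<close> tending to 0, that is \<open>Y = s z\<close> with \<open>z\<close> stationary. One
  step moves \<open>Y\<close> by \<open>s\<close> times an increment whose mean, on compact sets of \<open>Y\<close>, is nearly \<open>s\<close> times a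
  multiple of \<open>phic - phis\<close>, and whose variance is close to \<open>v = sigc a + sigs a\<close>, \<open>a\<close> being the common
  base rate. So stationarity, \<open>E f(Y') = E f(Y)\<close>, reads after a Taylor expansion and division by
  \<open>s\<^sup>2\<close>

    \<open>E [v / 2 * (f''(Y) - g(Y) f'(Y))] \<approx> 0\<close>

  for smooth bounded \<open>f\<close> with compactly supported derivative (\<open>second_order_balance\<close>),
  \<open>g\<close> being the drift function of the Gibbs law. The Gibbs law is the one
  under which this expectation is zero for all \<open>f\<close>. The proof makes this quantitative in the manner of
  Stein's method. Given a compactly supported \<open>u\<close> with Gibbs mean zero, the equation
  \<open>h' - g h = u\<close> has a compactly supported solution (\<open>gibbs_poisson_solution\<close>), whose primitive is
  such a bounded test function \<open>f\<close>; hence \<open>E u(Y)\<close> tends to 0 (\<open>centred_test_limit\<close>).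

  Compactly supported test functions keep the argument away from the region where the control curves
  may be large and the rates clipped. The price is that mass escaping to infinity must be excluded
  separately. This is the role of the negative drift condition: a bounded substitute for the quadratic
  Lyapunov function gives \<open>P(\<bar>Y\<bar> \<ge> N) \<le> T / N\<close> with \<open>T\<close> uniform in the family
  (\<open>tail_bound\<close>, \<open>tight\<close>), and clipping does not spoil the drift (\<open>clipped_drift_le\<close>). With
  tightness, the means of all bounded continuous functions converge (\<open>gibbs_limit_of_means\<close>), and the
  weak limit follows.

  If \<open>\<epsilon> / s\<close> tends to \<open>x\<close> and \<open>s \<tau>\<close> to \<open>y\<close>, the function \<open>g\<close> is the one with
  parameters \<open>x, y\<close> (\<open>scaled_imbalance_limit\<close>). The scale \<open>s = \<epsilon>\<close> gives \<open>x = 1, y = l\<close>,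
  and \<open>s = 1 / \<tau>\<close> gives \<open>x = l, y = 1\<close>. Since \<open>\<epsilon> \<tau>\<close> has a positive finite limit, either half of the
  asymptotic regime implies that both scales vanish.
\<close>

section \<open>Calculus on the line\<close>

lemma second_order_taylor:
  fixes f h k :: "real \<Rightarrow> real"
  assumes f: "\<And>t. (f has_real_derivative h t) (at t)"
    and h: "\<And>t. (h has_real_derivative k t) (at t)"
  obtains \<xi> where "\<bar>\<xi> - x\<bar> \<le> \<bar>d\<bar>" "f (x + d) = f x + h x * d + k \<xi> * d\<^sup>2 / 2"
proof (cases "d = 0")
  case True
  then show ?thesis using that[of x] by simp
next
  case False
  define D where "D m = (if m = 0 then f else if m = (1::nat) then h else k)" for m
  have "\<exists>t. (if x + d < x then x + d < t \<and> t < x else x < t \<and> t < x + d) \<and>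
     f (x + d) = (\<Sum>m<2. (D m x / fact m) * (x + d - x)^m) + (D 2 t / fact 2) * (x + d - x)^2"
  proof (rule Taylor[where a = "x - \<bar>d\<bar>" and b = "x + \<bar>d\<bar>"])
    show "\<forall>m t. m < 2 \<and> x - \<bar>d\<bar> \<le> t \<and> t \<le> x + \<bar>d\<bar> \<longrightarrow> DERIV (D m) t :> D (Suc m) t"
      using f h by (auto simp: D_def less_2_cases_iff)
  qed (use False in \<open>auto simp: D_def\<close>)
  then obtain t where "if x + d < x then x + d < t \<and> t < x else x < t \<and> t < x + d"
    and "f (x + d) = (\<Sum>m<2. (D m x / fact m) * (x + d - x)^m) + (D 2 t / fact 2) * (x + d - x)^2"
    by blast
  then show ?thesis
    using that[of t] by (auto simp: D_def numeral_2_eq_2 split: if_splits)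
qed

lemma compact_support_bounded:
  fixes f :: "real \<Rightarrow> real"
  assumes "continuous_on UNIV f" "\<And>t. \<bar>t\<bar> > R \<Longrightarrow> f t = 0"
  obtains B where "B > 0" "\<And>t. \<bar>f t\<bar> \<le> B"
proof -
  have "compact (f ` {-R..R})"
    by (intro compact_continuous_image continuous_on_subset[OF assms(1)]) auto
  then obtain B where "B > 0" and B: "\<And>t. t \<in> {-R..R} \<Longrightarrow> \<bar>f t\<bar> \<le> B"
    using compact_imp_bounded bounded_pos by (metis imageI real_norm_def)
  moreover have "\<bar>f t\<bar> \<le> B" for t
  proof (cases "\<bar>t\<bar> > R")
    case True
    then show ?thesis using assms(2) \<open>B > 0\<close> by simp
  next
    case False
    then have "t \<in> {-R..R}" by auto
    then show ?thesis by (rule B)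
  qed
  ultimately show ?thesis using that by blast
qed

text \<open>
  Uniform continuity in the form that the moment estimates can use: the threshold between
  small and large increments is absorbed into a linear term, so that taking expectations costs one
  more moment of the increment and needs no splitting of events.
\<close>

lemma continuous_almost_lipschitz_on_compact:
  fixes f :: "real \<Rightarrow> real"
  assumes "continuous_on {-R..R} f" "e > 0"
  obtains C where "C \<ge> 0"
    "\<And>a b. \<lbrakk>\<bar>a\<bar> \<le> R; \<bar>b\<bar> \<le> R\<rbrakk> \<Longrightarrow> \<bar>f a - f b\<bar> \<le> e + C * \<bar>a - b\<bar>"
proof -
  have "uniformly_continuous_on {-R..R} f"
    by (rule compact_uniformly_continuous[OF assms(1)]) simp
  then obtain \<delta> where \<delta>: "\<delta> > 0"
    "\<And>a b. \<lbrakk>a \<in> {-R..R}; b \<in> {-R..R}; \<bar>b - a\<bar> < \<delta>\<rbrakk> \<Longrightarrow> \<bar>f b - f a\<bar> < e"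
    using \<open>e > 0\<close> unfolding uniformly_continuous_on_def dist_real_def by metis
  obtain B where B: "B > 0" "\<And>t. t \<in> {-R..R} \<Longrightarrow> \<bar>f t\<bar> \<le> B"
    using compact_imp_bounded[OF compact_continuous_image[OF assms(1)]] bounded_pos
    by (metis compact_Icc imageI real_norm_def)
  show ?thesis
  proof (rule that[of "2 * B / \<delta>"])
    fix a b :: real assume ab: "\<bar>a\<bar> \<le> R" "\<bar>b\<bar> \<le> R"
    show "\<bar>f a - f b\<bar> \<le> e + 2 * B / \<delta> * \<bar>a - b\<bar>"
    proof (cases "\<bar>a - b\<bar> < \<delta>")
      case True
      then have "\<bar>f a - f b\<bar> < e"
        using ab \<delta>(2)[of b a] by (simp add: abs_le_iff)
      moreover have "0 \<le> 2 * B / \<delta> * \<bar>a - b\<bar>" using B \<delta> by simp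
      ultimately show ?thesis by linarith
    next
      case False
      then have "2 * B * 1 \<le> 2 * B * (\<bar>a - b\<bar> / \<delta>)"
        using B \<delta> by (intro mult_left_mono) (auto simp: field_simps)
      moreover have "\<bar>f a - f b\<bar> \<le> 2 * B" using B(2)[of a] B(2)[of b] ab by (simp add: abs_le_iff)
      ultimately show ?thesis using \<open>e > 0\<close> by simp
    qed
  qed (use B \<delta> in auto)
qed

lemma compact_support_almost_lipschitz:
  fixes f :: "real \<Rightarrow> real"
  assumes "continuous_on UNIV f" "\<And>t. \<bar>t\<bar> > R \<Longrightarrow> f t = 0" "e > 0"
  obtains C where "C \<ge> 0" "\<And>a b. \<bar>f a - f b\<bar> \<le> e + C * \<bar>a - b\<bar>"
proof -
  obtain C where C: "C \<ge> 0"
    "\<And>a b. \<lbrakk>\<bar>a\<bar> \<le> \<bar>R\<bar> + 1; \<bar>b\<bar> \<le> \<bar>R\<bar> + 1\<rbrakk> \<Longrightarrow> \<bar>f a - f b\<bar> \<le> e + C * \<bar>a - b\<bar>"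
    by (rule continuous_almost_lipschitz_on_compact[OF continuous_on_subset[OF assms(1)] \<open>e > 0\<close>]) auto
  \<comment> \<open>Projecting onto the interval does not change \<open>f\<close> and does not increase distances.\<close>
  define p where "p t = max (- (\<bar>R\<bar> + 1)) (min (\<bar>R\<bar> + 1) t)" for t :: real
  have p: "f (p t) = f t" "\<bar>p t\<bar> \<le> \<bar>R\<bar> + 1" for t
    using assms(2)[of t] assms(2)[of "p t"] by (auto simp: p_def max_def min_def)
  have "\<bar>f a - f b\<bar> \<le> e + C * \<bar>a - b\<bar>" for a b
  proof -
    have "\<bar>f a - f b\<bar> \<le> e + C * \<bar>p a - p b\<bar>"
      using C(2)[of "p a" "p b"] p by simp
    also have "\<dots> \<le> e + C * \<bar>a - b\<bar>"
      using C(1) by (intro add_left_mono mult_left_mono) (simp_all add: p_def max_def min_def)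
    finally show ?thesis .
  qed
  with C(1) show ?thesis using that by blast
qed

lemma integral_upto_has_derivative:
  fixes f :: "real \<Rightarrow> real"
  assumes "continuous_on UNIV f"
  shows "((\<lambda>t. LBINT y=ereal a..ereal t. f y) has_real_derivative f t) (at t)"
proof -
  let ?A = "- \<bar>t\<bar> - \<bar>a\<bar> - 1" and ?B = "\<bar>t\<bar> + \<bar>a\<bar> + 1"
  have "((\<lambda>u. LBINT y=ereal a..ereal u. f y) has_vector_derivative f t) (at t within {?A..?B})"
    by (intro interval_integral_FTC2 continuous_on_subset[OF assms]) auto
  then have "((\<lambda>u. LBINT y=ereal a..ereal u. f y) has_vector_derivative f t) (at t within {?A<..<?B})"
    by (rule has_vector_derivative_within_subset) auto
  then show ?thesis
    by (subst (asm) has_vector_derivative_within_open)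
       (auto simp: has_real_derivative_iff_has_vector_derivative)
qed

lemma increment_eq_integral:
  fixes F f :: "real \<Rightarrow> real"
  assumes "\<And>t. (F has_real_derivative f t) (at t)" "continuous_on UNIV f" "a \<le> b"
  shows "F b - F a = (\<integral>t. f t * indicator {a..b} t \<partial>lborel)"
  by (rule integral_FTC_Icc_real[symmetric])
     (use assms in \<open>auto simp: continuous_on_eq_continuous_at\<close>)

text \<open>
  An increment of \<open>F\<close> beyond \<open>R\<close> or \<open>- R\<close> is an integral of \<open>f\<close> over an interval on which
  \<open>f\<close> vanishes except possibly at its end point, a null set.
\<close>

lemma primitive_constant_outside:
  fixes F f :: "real \<Rightarrow> real"
  assumes F: "\<And>t. (F has_real_derivative f t) (at t)"
    and f: "continuous_on UNIV f" "\<And>t. \<bar>t\<bar> > R \<Longrightarrow> f t = 0"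
  shows "t \<ge> R \<Longrightarrow> F t = F R" "t \<le> - R \<Longrightarrow> F t = F (- R)"
proof -
  have null: "(\<integral>t. f t * indicator {a..b} t \<partial>lborel) = 0" if "a \<ge> R \<or> b \<le> - R" for a b
  proof -
    have "AE t in lborel. f t * indicator {a..b} t = 0"
      using AE_lborel_singleton[of R] AE_lborel_singleton[of "- R"]
      by eventually_elim (use f(2) that in \<open>force split: split_indicator\<close>)
    then show ?thesis
      using f(1) by (subst integral_cong_AE[where g = "\<lambda>_. 0"])
        (auto intro!: borel_measurable_times borel_measurable_continuous_onI[OF f(1)]
          borel_measurable_indicator simp del: mult_eq_0_iff)
  qed
  show "F t = F R" if "t \<ge> R"
    using increment_eq_integral[OF F f(1) that] null[of R t] by simp
  show "F t = F (- R)" if "t \<le> - R"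
    using increment_eq_integral[OF F f(1) that] null[of t "- R"] by simp
qed

section \<open>Gibbs weights and their Poisson equation\<close>

lemma gibbs_weight_pos: "gibbs_weight g t > 0"
  by (simp add: gibbs_weight_def)

lemma gibbs_weight_deriv:
  assumes "continuous_on UNIV g"
  shows "(gibbs_weight g has_real_derivative - g t * gibbs_weight g t) (at t)"
  unfolding gibbs_weight_def[abs_def]
  by (rule derivative_eq_intros integral_upto_has_derivative[OF assms] refl)+ simp

lemma gibbs_weight_continuous:
  assumes "continuous_on UNIV g"
  shows "continuous_on UNIV (gibbs_weight g)"
  using gibbs_weight_deriv[OF assms]
  by (auto simp: continuous_on_eq_continuous_at intro: DERIV_isCont)

lemma gibbs_weight_measurable:
  "continuous_on UNIV g \<Longrightarrow> gibbs_weight g \<in> borel_measurable borel"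
  by (rule borel_measurable_continuous_onI[OF gibbs_weight_continuous])

lemma integrable_exp_neg_abs:
  assumes "c > 0"
  shows "integrable lborel (\<lambda>t::real. exp (- c * \<bar>t\<bar>))"
proof -
  have "integrable lborel (\<lambda>t::real. inverse (1 + t\<^sup>2))"
    using integrable_inverse_1_plus_square by (simp add: set_integrable_def einterval_def)
  then have "integrable lborel (\<lambda>t::real. (1 + 2 / c\<^sup>2) * inverse (1 + t\<^sup>2))"
    by (rule integrable_mult_right)
  then show ?thesis
  proof (rule Bochner_Integration.integrable_bound)
    show "AE t in lborel. norm (exp (- c * \<bar>t\<bar>)) \<le> norm ((1 + 2 / c\<^sup>2) * inverse (1 + t\<^sup>2))"
    proof (rule AE_I2)
      fix t :: real
      have e: "1 + c * \<bar>t\<bar> + (c * \<bar>t\<bar>)\<^sup>2 / 2 \<le> exp (c * \<bar>t\<bar>)"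
        by (rule exp_lower_Taylor_quadratic) (use assms in simp)
      have "t\<^sup>2 = 2 / c\<^sup>2 * ((c * \<bar>t\<bar>)\<^sup>2 / 2)"
        using assms by (simp add: power_mult_distrib)
      also have "\<dots> \<le> 2 / c\<^sup>2 * exp (c * \<bar>t\<bar>)"
        using e assms by (intro mult_left_mono) (use mult_nonneg_nonneg[of c "\<bar>t\<bar>"] in linarith, simp)
      finally have "1 + t\<^sup>2 \<le> (1 + 2 / c\<^sup>2) * exp (c * \<bar>t\<bar>)"
        using assms by (simp add: algebra_simps add_mono)
      then have "exp (- c * \<bar>t\<bar>) \<le> (1 + 2 / c\<^sup>2) * inverse (1 + t\<^sup>2)"
        using assms by (simp add: exp_minus field_simps add_pos_nonneg)
      then show "norm (exp (- c * \<bar>t\<bar>)) \<le> norm ((1 + 2 / c\<^sup>2) * inverse (1 + t\<^sup>2))"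
        by simp
    qed
  qed simp
qed

text \<open>
  Since \<open>w' = - g w\<close>, the function \<open>w(t) exp(c t)\<close> decreases
  where \<open>g \<ge> c\<close>, and \<open>w(t) exp(- c t)\<close> increases where \<open>g \<le> - c\<close>. In between,
  compactness gives the bound.
\<close>

lemma gibbs_weight_exponential_bound:
  assumes g: "continuous_on UNIV g" and "c > 0"
    and right: "\<And>t. t > K \<Longrightarrow> g t \<ge> c" and left: "\<And>t. t < - K \<Longrightarrow> g t \<le> - c"
  obtains C where "C > 0" "\<And>t. gibbs_weight g t \<le> C * exp (- c * \<bar>t\<bar>)"
proof -
  let ?w = "gibbs_weight g" and ?K = "\<bar>K\<bar> + 1"
  have d: "((\<lambda>t. ?w t * exp (a * t)) has_real_derivative (a - g t) * (?w t * exp (a * t))) (at t)" for a t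
    by (rule derivative_eq_intros gibbs_weight_deriv[OF g] refl)+ (simp add: algebra_simps)
  have "compact ((\<lambda>t. ?w t * exp (c * \<bar>t\<bar>)) ` {-?K..?K})"
    by (intro compact_continuous_image continuous_intros
        continuous_on_subset[OF gibbs_weight_continuous[OF g]]) auto
  then obtain C where C: "C > 0"
    and C': "\<forall>x\<in>(\<lambda>t. ?w t * exp (c * \<bar>t\<bar>)) ` {-?K..?K}. norm x \<le> C"
    using compact_imp_bounded bounded_pos by metis
  have C'': "?w t * exp (c * \<bar>t\<bar>) \<le> C" if "\<bar>t\<bar> \<le> ?K" for t
    using C' that abs_le_D1 by (fastforce simp: abs_le_iff)
  have "?w t * exp (c * \<bar>t\<bar>) \<le> C" for t
  proof -
    consider "\<bar>t\<bar> \<le> ?K" | "t > ?K" | "t < - ?K" by linarith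
    then show ?thesis
    proof cases
      case 2
      have "?w t * exp (c * t) \<le> ?w ?K * exp (c * ?K)"
      proof (rule DERIV_nonpos_imp_nonincreasing[where f = "\<lambda>t. ?w t * exp (c * t)"])
        fix x assume "?K \<le> x" "x \<le> t"
        then have "(c - g x) * (?w x * exp (c * x)) \<le> 0"
          using right[of x] gibbs_weight_pos[of g x] by (intro mult_nonpos_nonneg) auto
        then show "\<exists>y. ((\<lambda>t. ?w t * exp (c * t)) has_real_derivative y) (at x) \<and> y \<le> 0"
          using d[of c x] by (intro exI[of _ "(c - g x) * (?w x * exp (c * x))"] conjI)
      qed (use 2 in simp)
      then show ?thesis using C''[of ?K] 2 by simp
    next
      case 3
      have "?w t * exp (- c * t) \<le> ?w (- ?K) * exp (- c * (- ?K))"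
      proof (rule DERIV_nonneg_imp_nondecreasing[where f = "\<lambda>t. ?w t * exp (- c * t)"])
        fix x assume "t \<le> x" "x \<le> - ?K"
        then have "(- c - g x) * (?w x * exp (- c * x)) \<ge> 0"
          using left[of x] gibbs_weight_pos[of g x] by (intro mult_nonneg_nonneg) auto
        then show "\<exists>y. ((\<lambda>t. ?w t * exp (- c * t)) has_real_derivative y) (at x) \<and> y \<ge> 0"
          using d[of "- c" x] by (intro exI[of _ "(- c - g x) * (?w x * exp (- c * x))"] conjI)
      qed (use 3 in simp)
      then show ?thesis using C''[of "- ?K"] 3 by (simp add: algebra_simps)
    qed (use C'' in auto)
  qed
  then have "?w t \<le> C * exp (- c * \<bar>t\<bar>)" for t
    by (simp add: exp_minus field_simps)
  with C show ?thesis using that by blast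
qed

lemma gibbs_normalizable_if_confining:
  assumes g: "continuous_on UNIV g" and "c > 0"
    and "\<And>t. t > K \<Longrightarrow> g t \<ge> c" "\<And>t. t < - K \<Longrightarrow> g t \<le> - c"
  shows "gibbs_normalizable g"
proof -
  obtain C where C: "C > 0" "\<And>t. gibbs_weight g t \<le> C * exp (- c * \<bar>t\<bar>)"
    using gibbs_weight_exponential_bound[OF assms] by blast
  show ?thesis
    unfolding gibbs_normalizable_def
    by (rule Bochner_Integration.integrable_bound[OF integrable_mult_right[OF integrable_exp_neg_abs[OF \<open>c > 0\<close>], of C]])
       (use C gibbs_weight_measurable[OF g] in \<open>auto simp: gibbs_weight_pos less_imp_le\<close>)
qed

lemma gibbs_partition_pos:
  assumes "continuous_on UNIV g" "gibbs_normalizable g"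
  shows "(\<integral>t. gibbs_weight g t \<partial>lborel) > 0"
proof -
  have "(\<integral>t. gibbs_weight g t \<partial>lborel) \<noteq> 0"
  proof
    assume "(\<integral>t. gibbs_weight g t \<partial>lborel) = 0"
    then have "AE t in lborel. gibbs_weight g t = 0"
      using assms(2) by (subst (asm) integral_nonneg_eq_0_iff_AE)
        (auto simp: gibbs_normalizable_def gibbs_weight_pos less_imp_le)
    then have "AE t in (lborel :: real measure). False"
      by (rule AE_mp) (auto intro!: AE_I2 simp: gibbs_weight_pos[THEN less_imp_neq, symmetric])
    then show False
      by (simp add: ae_filter_eq_bot_iff trivial_limit_def[symmetric])
  qed
  moreover have "(\<integral>t. gibbs_weight g t \<partial>lborel) \<ge> 0"
    by (intro integral_nonneg_AE) (auto simp: gibbs_weight_pos less_imp_le)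
  ultimately show ?thesis by linarith
qed

lemma integral_Gibbs:
  fixes u :: "real \<Rightarrow> real"
  assumes "continuous_on UNIV g" "gibbs_normalizable g" "u \<in> borel_measurable borel"
  shows "(\<integral>t. u t \<partial>Gibbs g) = (\<integral>t. u t * gibbs_weight g t \<partial>lborel) / (\<integral>t. gibbs_weight g t \<partial>lborel)"
proof -
  have "(\<integral>t. u t \<partial>Gibbs g) = (\<integral>t. gibbs_weight g t / (\<integral>t. gibbs_weight g t \<partial>lborel) * u t \<partial>lborel)"
    unfolding Gibbs_def
    using gibbs_partition_pos[OF assms(1,2)] assms(3) gibbs_weight_measurable[OF assms(1)]
    by (subst integral_density) (auto simp: gibbs_weight_pos less_imp_le)
  then show ?thesis by (simp add: mult.commute flip: integral_divide_zero)
qed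

lemma real_distribution_Gibbs:
  assumes "continuous_on UNIV g" "gibbs_normalizable g"
  shows "real_distribution (Gibbs g)"
proof -
  let ?Z = "\<integral>t. gibbs_weight g t \<partial>lborel"
  note Z = gibbs_partition_pos[OF assms]
  have m[measurable]: "gibbs_weight g \<in> borel_measurable borel"
    by (rule gibbs_weight_measurable[OF assms(1)])
  have "emeasure (Gibbs g) UNIV = (\<integral>\<^sup>+t. ennreal (gibbs_weight g t / ?Z) \<partial>lborel)"
    unfolding Gibbs_def by (subst emeasure_density) auto
  also have "\<dots> = ennreal (\<integral>t. gibbs_weight g t / ?Z \<partial>lborel)"
    using assms(2) Z
    by (intro nn_integral_eq_integral) (auto simp: gibbs_normalizable_def gibbs_weight_pos less_imp_le)
  also have "\<dots> = 1" using Z by simp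
  finally have "prob_space (Gibbs g)"
    by (intro prob_spaceI) (simp add: Gibbs_def)
  then show ?thesis
    by (simp add: real_distribution_def real_distribution_axioms_def Gibbs_def)
qed

text \<open>
  The Poisson (or Stein) equation of the limiting diffusion. As \<open>w' = - g w\<close>, the equation
  \<open>h' - g h = u\<close> says \<open>(h w)' = u w\<close>, hence \<open>h = U / w\<close> with \<open>U\<close> the integral of
  \<open>u w\<close> from the left. For compactly supported \<open>u\<close> the function \<open>U\<close> vanishes to the left of
  the support, and to its right it equals the total integral of \<open>u w\<close>. This is the reason for
  restricting to \<open>u\<close> of Gibbs mean zero: exactly then \<open>h\<close> has compact support as well, and
  its primitive \<open>f\<close> is bounded, so that \<open>f\<close> is a legitimate test function for stationarity.
\<close>

lemma gibbs_poisson_solution: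
  fixes g u :: "real \<Rightarrow> real"
  assumes g: "continuous_on UNIV g" and u: "continuous_on UNIV u"
    and supp: "\<And>t. \<bar>t\<bar> > R \<Longrightarrow> u t = 0"
    and centred: "(\<integral>t. u t * gibbs_weight g t \<partial>lborel) = 0"
  obtains f h k where
    "\<And>t. (f has_real_derivative h t) (at t)" "\<And>t. (h has_real_derivative k t) (at t)"
    "\<And>t. k t - g t * h t = u t" "\<And>t. \<bar>t\<bar> > \<bar>R\<bar> \<Longrightarrow> h t = 0" "\<And>t. \<bar>t\<bar> > \<bar>R\<bar> \<Longrightarrow> k t = 0"
    "continuous_on UNIV h" "continuous_on UNIV k" "bounded (range f)"
proof -
  let ?w = "gibbs_weight g"
  define R' where "R' = \<bar>R\<bar>"
  have supp': "u t = 0" if "\<bar>t\<bar> > R'" for t using supp[of t] that by (auto simp: R'_def)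
  have uw: "continuous_on UNIV (\<lambda>t. u t * ?w t)"
    by (intro continuous_intros u gibbs_weight_continuous[OF g])
  define U where "U t = (LBINT y=ereal (- R')..ereal t. u y * ?w y)" for t
  have dU: "(U has_real_derivative u t * ?w t) (at t)" for t
    unfolding U_def[abs_def] by (rule integral_upto_has_derivative[OF uw])
  have U0: "U (- R') = 0" by (simp add: U_def)
  have "U R' - U (- R') = (\<integral>t. u t * ?w t * indicator {-R'..R'} t \<partial>lborel)"
    by (rule increment_eq_integral[OF dU uw]) (simp add: R'_def)
  also have "\<dots> = (\<integral>t. u t * ?w t \<partial>lborel)"
    using supp' by (intro Bochner_Integration.integral_cong)
      (auto split: split_indicator simp: abs_le_iff not_le, (smt (verit))?)
  finally have "U R' = 0" using centred U0 by simp
  then have U_out: "U t = 0" if "\<bar>t\<bar> > R'" for t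
    using primitive_constant_outside[of U "\<lambda>t. u t * ?w t" R' t, OF dU uw] supp' U0 that
    by (cases "t \<ge> R'") auto
  define h where "h t = U t / ?w t" for t
  define k where "k t = u t + g t * h t" for t
  have dh: "(h has_real_derivative k t) (at t)" for t
    unfolding h_def[abs_def]
    by (rule derivative_eq_intros dU gibbs_weight_deriv[OF g] refl)+
       (use gibbs_weight_pos[of g t] in \<open>simp_all add: k_def h_def field_simps\<close>)
  have ch: "continuous_on UNIV h"
    using dh by (auto simp: continuous_on_eq_continuous_at intro: DERIV_isCont)
  have h_out: "h t = 0" if "\<bar>t\<bar> > R'" for t using U_out[OF that] by (simp add: h_def)
  define f where "f t = (LBINT y=ereal 0..ereal t. h y)" for t
  have df: "(f has_real_derivative h t) (at t)" for t
    unfolding f_def[abs_def] by (rule integral_upto_has_derivative[OF ch])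
  have "range f \<subseteq> f ` {-R'..R'}"
  proof safe
    fix t
    note o = primitive_constant_outside[of f h R' t, OF df ch h_out]
    consider "t \<in> {-R'..R'}" | "t \<ge> R'" | "t \<le> - R'" by fastforce
    then show "f t \<in> f ` {-R'..R'}"
      using o by cases (auto simp: R'_def)
  qed
  moreover have "compact (f ` {-R'..R'})"
    by (intro compact_continuous_image)
       (use df in \<open>auto intro!: continuous_at_imp_continuous_on DERIV_isCont\<close>)
  ultimately have bf: "bounded (range f)"
    using bounded_subset compact_imp_bounded by blast
  show ?thesis
    by (rule that[OF df dh _ _ _ ch _ bf])
       (use supp' h_out in \<open>auto simp: k_def[abs_def] R'_def intro!: continuous_intros u g ch\<close>)
qed

section \<open>Weak convergence along a filter\<close>

text \<open>
  The distribution function at \<open>x\<close> lies between the means of the continuous steps that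
  end at \<open>x\<close> and that start at \<open>x\<close>. The argument is the one for sequences, with limits along
  the filter instead of upper and lower limits.
\<close>

lemma weak_conv_along_cts_stepI:
  assumes D: "\<forall>\<^sub>F i in F. real_distribution (D i)" and N: "real_distribution N"
    and conv: "\<And>x y. x < y \<Longrightarrow> ((\<lambda>i. \<integral>t. cts_step x y t \<partial>D i) \<longlongrightarrow> (\<integral>t. cts_step x y t \<partial>N)) F"
  shows "weak_conv_along F D N"
  unfolding weak_conv_along_def
proof (intro allI impI)
  fix x assume x: "isCont (cdf N) x"
  interpret N: real_distribution N by (rule N)
  show "((\<lambda>i. cdf (D i) x) \<longlongrightarrow> cdf N x) F"
  proof (rule order_tendstoI)
    fix a assume "a < cdf N x"
    then have "\<forall>\<^sub>F y in at x. a < cdf N y"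
      using x unfolding isCont_def by (rule order_tendstoD(1)[rotated])
    then have "\<forall>\<^sub>F y in at_left x. a < cdf N y"
      by (rule filter_leD[OF at_le, rotated]) simp
    then obtain y where y: "y < x" "a < cdf N y"
      by (metis eventually_at_left_field lt_ex dense)
    have "a < (\<integral>t. cts_step y x t \<partial>N)" using N.cdf_cts_step(1)[OF y(1)] y(2) by linarith
    then have "\<forall>\<^sub>F i in F. a < (\<integral>t. cts_step y x t \<partial>D i)"
      using conv[OF y(1)] by (rule order_tendstoD(1)[rotated])
    with D show "\<forall>\<^sub>F i in F. a < cdf (D i) x"
      by eventually_elim (use real_distribution.cdf_cts_step(2)[OF _ y(1)] in fastforce)
  next
    fix a assume "cdf N x < a"
    then have "\<forall>\<^sub>F y in at x. cdf N y < a"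
      using x unfolding isCont_def by (rule order_tendstoD(2)[rotated])
    then have "\<forall>\<^sub>F y in at_right x. cdf N y < a"
      by (rule filter_leD[OF at_le, rotated]) simp
    then obtain y where y: "x < y" "cdf N y < a"
      by (metis eventually_at_right_field gt_ex dense)
    have "(\<integral>t. cts_step x y t \<partial>N) < a" using N.cdf_cts_step(2)[OF y(1)] y(2) by linarith
    then have "\<forall>\<^sub>F i in F. (\<integral>t. cts_step x y t \<partial>D i) < a"
      using conv[OF y(1)] by (rule order_tendstoD(2)[rotated])
    with D show "\<forall>\<^sub>F i in F. cdf (D i) x < a"
      by eventually_elim (use real_distribution.cdf_cts_step(1)[OF _ y(1)] in fastforce)
  qed
qed

lemma weak_conv_along_cong:
  assumes "\<forall>\<^sub>F i in F. D i = D' i"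
  shows "weak_conv_along F D N \<longleftrightarrow> weak_conv_along F D' N"
proof -
  have "((\<lambda>i. cdf (D i) x) \<longlongrightarrow> z) F \<longleftrightarrow> ((\<lambda>i. cdf (D' i) x) \<longlongrightarrow> z) F" for x z
    by (rule tendsto_cong) (use assms in \<open>auto elim: eventually_mono\<close>)
  then show ?thesis by (simp add: weak_conv_along_def)
qed

section \<open>Stationary walks on the integers\<close>

lemma integer_powers_le_cube:
  fixes n :: int
  shows "\<bar>real_of_int n\<bar> \<le> \<bar>real_of_int n\<bar> ^ 3" "(real_of_int n)\<^sup>2 \<le> \<bar>real_of_int n\<bar> ^ 3"
proof -
  have "\<bar>real_of_int n\<bar> \<ge> 1" if "n \<noteq> 0" using that by linarith
  then show "\<bar>real_of_int n\<bar> \<le> \<bar>real_of_int n\<bar> ^ 3"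
    "(real_of_int n)\<^sup>2 \<le> \<bar>real_of_int n\<bar> ^ 3"
    using power_increasing[of 1 3 "\<bar>real_of_int n\<bar>"] power_increasing[of 2 3 "\<bar>real_of_int n\<bar>"]
    by (cases "n = 0"; simp)+
qed

definition drift :: "'w measure \<Rightarrow> (int \<Rightarrow> 'w \<Rightarrow> int) \<Rightarrow> int \<Rightarrow> real" where
  "drift P X i = (\<integral>w. real_of_int (X i w) \<partial>P)"

definition second_moment :: "'w measure \<Rightarrow> (int \<Rightarrow> 'w \<Rightarrow> int) \<Rightarrow> int \<Rightarrow> real" where
  "second_moment P X i = (\<integral>w. (real_of_int (X i w))\<^sup>2 \<partial>P)"

text \<open>
  One queue, reduced to what the limit theorem sees of it. \<open>X i\<close> is the increment out of
  state \<open>i\<close>, and \<open>D\<close> is a stationary law. Stationarity is stated for bounded test functions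
  only, because no moment of \<open>D\<close> is known in advance.
\<close>

locale stationary_walk = prob_space P for P :: "'w measure" +
  fixes X :: "int \<Rightarrow> 'w \<Rightarrow> int" and D :: "int measure" and M :: real
  assumes step_measurable: "X i \<in> measurable P (count_space UNIV)"
    and third_integrable: "integrable P (\<lambda>w. \<bar>real_of_int (X i w)\<bar> ^ 3)"
    and third_moment: "expectation (\<lambda>w. \<bar>real_of_int (X i w)\<bar> ^ 3) \<le> M"
    and prob_space_D: "prob_space D"
    and sets_D: "sets D = UNIV"
    and stationary: "\<And>f :: int \<Rightarrow> real. bounded (range f) \<Longrightarrow>
      (\<integral>i. expectation (\<lambda>w. f (i + X i w)) \<partial>D) = (\<integral>i. f i \<partial>D)"
begin

sublocale D: prob_space D by (rule prob_space_D)

lemma measurable_D [measurable]: "f \<in> measurable D (borel :: real measure)"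
  using sets_eq_imp_space_eq[of D "count_space UNIV"] sets_D by (auto simp: measurable_def)

lemma integrable_D:
  fixes f :: "int \<Rightarrow> real"
  shows "(\<And>i. \<bar>f i\<bar> \<le> B) \<Longrightarrow> integrable D f"
  by (rule D.integrable_const_bound[of _ B]) auto

lemma measurable_step: "(\<lambda>w. f (X i w) :: real) \<in> borel_measurable P"
  by (rule measurable_compose[OF step_measurable]) simp

lemma integrable_step:
  "integrable P (\<lambda>w. real_of_int (X i w))" "integrable P (\<lambda>w. (real_of_int (X i w))\<^sup>2)"
  using third_integrable[of i] integer_powers_le_cube measurable_step[of _ i]
  by (auto intro!: Bochner_Integration.integrable_bound[OF third_integrable[of i]])

lemma moment_bounds: "\<bar>drift P X i\<bar> \<le> M" "0 \<le> second_moment P X i" "second_moment P X i \<le> M"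
proof -
  have "\<bar>drift P X i\<bar> \<le> expectation (\<lambda>w. \<bar>real_of_int (X i w)\<bar> ^ 3)"
    unfolding drift_def
    by (rule order_trans[OF integral_abs_bound integral_mono])
       (use integrable_step third_integrable integer_powers_le_cube in \<open>auto intro: integrable_abs\<close>)
  then show "\<bar>drift P X i\<bar> \<le> M" using third_moment[of i] by linarith
  have "second_moment P X i \<le> expectation (\<lambda>w. \<bar>real_of_int (X i w)\<bar> ^ 3)"
    unfolding second_moment_def
    by (rule integral_mono) (use integrable_step third_integrable integer_powers_le_cube in auto)
  then show "second_moment P X i \<le> M" using third_moment[of i] by linarith
  show "0 \<le> second_moment P X i" unfolding second_moment_def by (intro integral_nonneg_AE) auto
qed

text \<open>
  The generator applied to a bounded \<open>f\<close> has stationary mean zero. Therefore anything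
  uniformly close to it has a small stationary mean.
\<close>

lemma stationary_mean_le:
  fixes f b :: "int \<Rightarrow> real"
  assumes f: "bounded (range f)"
    and approx: "\<And>i. \<bar>expectation (\<lambda>w. f (i + X i w)) - f i - b i\<bar> \<le> e"
  shows "\<bar>\<integral>i. b i \<partial>D\<bar> \<le> e"
proof -
  obtain B where B: "\<And>i. \<bar>f i\<bar> \<le> B" using f by (auto simp: bounded_iff)
  define E where "E i = expectation (\<lambda>w. f (i + X i w))" for i
  have E: "\<bar>E i\<bar> \<le> B" for i
  proof -
    have "\<bar>E i\<bar> \<le> expectation (\<lambda>w. \<bar>f (i + X i w)\<bar>)" unfolding E_def by (rule integral_abs_bound)
    also have "\<dots> \<le> expectation (\<lambda>w. B)"
      using B by (intro integral_mono integrable_const_bound[of _ B] AE_I2)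
        (auto intro: measurable_step[of "\<lambda>n. \<bar>f (i + n)\<bar>"] order_trans[OF abs_ge_zero])
    finally show ?thesis by (simp add: prob_space)
  qed
  have b: "\<bar>b i\<bar> \<le> e + 2 * B" for i
    using approx[of i] E[of i] B[of i] unfolding E_def by linarith
  note int = integrable_D[OF E] integrable_D[OF B] integrable_D[OF b]
  have "(\<integral>i. b i \<partial>D) = (\<integral>i. b i - (E i - f i) \<partial>D)"
    using int stationary[OF f] by (simp add: E_def)
  also have "\<bar>\<dots>\<bar> \<le> (\<integral>i. \<bar>b i - (E i - f i)\<bar> \<partial>D)" by (rule integral_abs_bound)
  also have "\<dots> \<le> (\<integral>i. e \<partial>D)"
    using approx int unfolding E_def[symmetric]
    by (intro integral_mono integrable_abs Bochner_Integration.integrable_diff)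
       (auto simp: abs_minus_commute)
  finally show ?thesis by (simp add: D.prob_space)
qed

lemma expected_taylor:
  fixes f :: "real \<Rightarrow> real"
  assumes f: "bounded (range f)" "p \<ge> 0" "q \<ge> 0"
    and taylor: "\<And>n. \<bar>f (s * of_int (i + n)) - f (s * of_int i) - a * of_int n - b * (of_int n)\<^sup>2\<bar>
      \<le> p * (of_int n)\<^sup>2 + q * \<bar>of_int n\<bar> ^ 3"
  shows "\<bar>expectation (\<lambda>w. f (s * of_int (i + X i w))) - f (s * of_int i)
      - (a * drift P X i + b * second_moment P X i)\<bar> \<le> (p + q) * M"
proof -
  let ?Y = "\<lambda>w. real_of_int (X i w)"
  obtain B where B: "\<And>t. \<bar>f t\<bar> \<le> B" using f(1) by (auto simp: bounded_iff)
  have int_f: "integrable P (\<lambda>w. f (s * of_int (i + X i w)))"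
    using B by (intro integrable_const_bound[of _ B] measurable_step[of "\<lambda>n. f (s * of_int (i + n))"]) auto
  note int = int_f integrable_step[of i] third_integrable[of i]
  have "\<bar>expectation (\<lambda>w. f (s * of_int (i + X i w))) - f (s * of_int i)
      - (a * drift P X i + b * second_moment P X i)\<bar>
    = \<bar>expectation (\<lambda>w. f (s * of_int (i + X i w)) - f (s * of_int i) - a * ?Y w - b * (?Y w)\<^sup>2)\<bar>"
    using int by (simp add: drift_def second_moment_def prob_space)
  also have "\<dots> \<le> expectation (\<lambda>w. \<bar>f (s * of_int (i + X i w)) - f (s * of_int i) - a * ?Y w - b * (?Y w)\<^sup>2\<bar>)"
    by (rule integral_abs_bound)
  also have "\<dots> \<le> expectation (\<lambda>w. p * (?Y w)\<^sup>2 + q * \<bar>?Y w\<bar> ^ 3)"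
    by (intro integral_mono taylor) (use int in auto)
  also have "\<dots> = p * second_moment P X i + q * expectation (\<lambda>w. \<bar>?Y w\<bar> ^ 3)"
    using int by (simp add: second_moment_def)
  also have "\<dots> \<le> p * M + q * M"
    using moment_bounds(3)[of i] third_moment[of i] f by (intro add_mono mult_left_mono) auto
  finally show ?thesis by (simp add: algebra_simps)
qed

text \<open>
  Stationarity with a second-order remainder. The test function is evaluated at
  \<open>s i\<close>; the drift is of order \<open>s\<close> and the remainder of order \<open>s\<^sup>2\<close>, so after division by
  \<open>s\<^sup>2\<close> both are of order one. Used for tightness, where only an upper bound matters.
\<close>

lemma first_order_balance:
  fixes f h k :: "real \<Rightarrow> real"
  assumes f: "\<And>t. (f has_real_derivative h t) (at t)" "bounded (range f)"
    and h: "\<And>t. (h has_real_derivative k t) (at t)"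
    and k: "\<And>t. \<bar>k t\<bar> \<le> C" and s: "s > 0"
  shows "\<bar>\<integral>i. h (s * of_int i) * (drift P X i / s) \<partial>D\<bar> \<le> C * M / 2"
proof -
  have C: "C \<ge> 0" using k[of 0] by linarith
  have "\<bar>\<integral>i. h (s * of_int i) * s * drift P X i + 0 * second_moment P X i \<partial>D\<bar> \<le> (C * s\<^sup>2 / 2 + 0) * M"
  proof (rule stationary_mean_le[where f = "\<lambda>i. f (s * of_int i)"], goal_cases)
    case 1
    show ?case by (rule bounded_subset[OF f(2)]) auto
  next
    case (2 i)
    show ?case
    proof (rule expected_taylor)
      fix n
      obtain \<xi> where "f (s * of_int i + s * of_int n) = f (s * of_int i) + h (s * of_int i) * (s * of_int n)
          + k \<xi> * (s * of_int n)\<^sup>2 / 2"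
        by (rule second_order_taylor[OF f(1) h])
      then have "f (s * of_int (i + n)) - f (s * of_int i) - h (s * of_int i) * s * of_int n - 0 * (of_int n)\<^sup>2
          = k \<xi> * ((s * of_int n)\<^sup>2 / 2)"
        by (simp add: algebra_simps)
      also have "\<bar>\<dots>\<bar> \<le> C * ((s * of_int n)\<^sup>2 / 2)"
        unfolding abs_mult by (intro mult_mono k) (auto simp: C)
      finally show "\<bar>f (s * of_int (i + n)) - f (s * of_int i) - h (s * of_int i) * s * of_int n
          - 0 * (of_int n)\<^sup>2\<bar> \<le> C * s\<^sup>2 / 2 * (of_int n)\<^sup>2 + 0 * \<bar>of_int n\<bar> ^ 3"
        by (simp add: power_mult_distrib)
    qed (use f C in auto)
  qed
  moreover have "(\<integral>i. h (s * of_int i) * s * drift P X i + 0 * second_moment P X i \<partial>D)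
      = s\<^sup>2 * (\<integral>i. h (s * of_int i) * (drift P X i / s) \<partial>D)"
    using s by (subst integral_mult_right_zero[symmetric], intro Bochner_Integration.integral_cong)
      (auto simp: power2_eq_square)
  ultimately have "s\<^sup>2 * \<bar>\<integral>i. h (s * of_int i) * (drift P X i / s) \<partial>D\<bar> \<le> s\<^sup>2 * (C * M / 2)"
    by (simp add: abs_mult mult_ac)
  then show ?thesis by (rule mult_left_le_imp_le) (use s in simp)
qed

text \<open>
  The same expansion one order further: the second moment now enters exactly and the
  remainder vanishes as \<open>s\<close> and \<open>e\<close> do. The third moment of the increment is needed for the
  Lipschitz part of the oscillation of \<open>k\<close>.
\<close>

lemma second_order_balance:
  fixes f h k :: "real \<Rightarrow> real"
  assumes f: "\<And>t. (f has_real_derivative h t) (at t)" "bounded (range f)"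
    and h: "\<And>t. (h has_real_derivative k t) (at t)"
    and k: "\<And>a b. \<bar>k a - k b\<bar> \<le> e + C * \<bar>a - b\<bar>" "e \<ge> 0" "C \<ge> 0" and s: "s > 0"
  shows "\<bar>\<integral>i. h (s * of_int i) * (drift P X i / s) + k (s * of_int i) * (second_moment P X i / 2) \<partial>D\<bar>
    \<le> (e + C * s) * M / 2"
proof -
  have "\<bar>\<integral>i. h (s * of_int i) * s * drift P X i + k (s * of_int i) * s\<^sup>2 / 2 * second_moment P X i \<partial>D\<bar>
    \<le> (e * s\<^sup>2 / 2 + C * s ^ 3 / 2) * M"
  proof (rule stationary_mean_le[where f = "\<lambda>i. f (s * of_int i)"], goal_cases)
    case 1
    show ?case by (rule bounded_subset[OF f(2)]) auto
  next
    case (2 i)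
    show ?case
    proof (rule expected_taylor)
      fix n
      let ?y = "s * of_int i" and ?d = "s * of_int n"
      obtain \<xi> where \<xi>: "\<bar>\<xi> - ?y\<bar> \<le> \<bar>?d\<bar>" and "f (?y + ?d) = f ?y + h ?y * ?d + k \<xi> * ?d\<^sup>2 / 2"
        by (rule second_order_taylor[OF f(1) h])
      then have "f (s * of_int (i + n)) - f ?y - h ?y * s * of_int n - k ?y * s\<^sup>2 / 2 * (of_int n)\<^sup>2
          = (k \<xi> - k ?y) * (?d\<^sup>2 / 2)"
        by (simp add: algebra_simps power_mult_distrib)
      also have "\<bar>\<dots>\<bar> \<le> (e + C * \<bar>?d\<bar>) * (?d\<^sup>2 / 2)"
      proof -
        have "\<bar>k \<xi> - k ?y\<bar> \<le> e + C * \<bar>?d\<bar>"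
          using k(1)[of \<xi> ?y] mult_left_mono[OF \<xi> k(3)] by linarith
        then show ?thesis unfolding abs_mult by (intro mult_mono) (use k in auto)
      qed
      also have "\<dots> = e * s\<^sup>2 / 2 * (of_int n)\<^sup>2 + C * s ^ 3 / 2 * \<bar>of_int n\<bar> ^ 3"
      proof -
        have "?d\<^sup>2 = s\<^sup>2 * \<bar>of_int n\<bar>\<^sup>2" "\<bar>?d\<bar> = s * \<bar>of_int n\<bar>"
          using s by (simp_all add: power_mult_distrib abs_mult)
        then show ?thesis
          by (simp add: algebra_simps power2_eq_square power3_eq_cube)
      qed
      finally show "\<bar>f (s * of_int (i + n)) - f ?y - h ?y * s * of_int n
          - k ?y * s\<^sup>2 / 2 * (of_int n)\<^sup>2\<bar> \<le> e * s\<^sup>2 / 2 * (of_int n)\<^sup>2 + C * s ^ 3 / 2 * \<bar>of_int n\<bar> ^ 3" .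
    qed (use f k s in auto)
  qed
  moreover have "(\<integral>i. h (s * of_int i) * s * drift P X i + k (s * of_int i) * s\<^sup>2 / 2 * second_moment P X i \<partial>D)
      = s\<^sup>2 * (\<integral>i. h (s * of_int i) * (drift P X i / s) + k (s * of_int i) * (second_moment P X i / 2) \<partial>D)"
    using s by (subst integral_mult_right_zero[symmetric], intro Bochner_Integration.integral_cong)
      (auto simp: power2_eq_square algebra_simps)
  moreover have "(e * s\<^sup>2 / 2 + C * s ^ 3 / 2) * M = s\<^sup>2 * ((e + C * s) * M / 2)"
    by (simp add: algebra_simps power2_eq_square power3_eq_cube)
  ultimately have "s\<^sup>2 * \<bar>\<integral>i. h (s * of_int i) * (drift P X i / s) + k (s * of_int i) * (second_moment P X i / 2) \<partial>D\<bar>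
      \<le> s\<^sup>2 * ((e + C * s) * M / 2)"
    by (simp add: abs_mult)
  then show ?thesis by (rule mult_left_le_imp_le) (use s in simp)
qed

text \<open>
  A quadratic Lyapunov function \<open>t\<^sup>2 / 2\<close> would bound the stationary mean of
  \<open>\<bar>s i\<bar>\<close>, because its derivative \<open>t\<close> is multiplied by a drift of size at least \<open>c\<close>
  pointing to the origin. It is unbounded, so it is replaced by
  \<open>R\<^sup>2 (1 - exp(- t\<^sup>2 / (2 R\<^sup>2)))\<close>. This is bounded, its second derivative is bounded
  by 2 independently of \<open>R\<close>, and its derivative is still at least half of \<open>\<bar>t\<bar>\<close> on
  \<open>[- R, R]\<close>. Markov's inequality on that interval has a constant that does not depend on
  \<open>R\<close>, so \<open>R\<close> may go to infinity.
\<close>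

lemma tail_bound:
  assumes s: "s > 0" and c: "c > 0" and K: "K \<ge> 0" and B: "B \<ge> 0" and N: "N > 0"
    and right: "\<And>i. s * of_int i > K \<Longrightarrow> drift P X i / s \<le> - c"
    and left: "\<And>i. s * of_int i < - K \<Longrightarrow> drift P X i / s \<ge> c"
    and centre: "\<And>i. \<bar>s * of_int i\<bar> \<le> K \<Longrightarrow> \<bar>drift P X i / s\<bar> \<le> B"
  shows "measure D {i. N \<le> \<bar>s * of_int i\<bar>} \<le> 2 * (M + K * (B + c)) / c / N"
proof -
  let ?T = "M + K * (B + c)"
  have bound: "measure D {i. N \<le> \<bar>s * of_int i\<bar> \<and> \<bar>s * of_int i\<bar> \<le> R} \<le> 2 * ?T / c / N"
    if R: "R > 0" for R :: real
  proof -
    define f where "f t = R\<^sup>2 * (1 - exp (- (t\<^sup>2 / (2 * R\<^sup>2))))" for t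
    define h where "h t = t * exp (- (t\<^sup>2 / (2 * R\<^sup>2)))" for t
    define k where "k t = (1 - 2 * (t\<^sup>2 / (2 * R\<^sup>2))) * exp (- (t\<^sup>2 / (2 * R\<^sup>2)))" for t
    have f: "(f has_real_derivative h t) (at t)" for t
      unfolding f_def[abs_def] h_def using R
      by (auto intro!: derivative_eq_intros simp: power2_eq_square)
    have h: "(h has_real_derivative k t) (at t)" for t
      unfolding h_def[abs_def] k_def using R
      by (auto intro!: derivative_eq_intros simp: power2_eq_square field_simps)
    have bf: "bounded (range f)"
      unfolding bounded_iff
      by (rule exI[of _ "R\<^sup>2"]) (auto simp: f_def abs_mult intro!: mult_left_le)
    have k: "\<bar>k t\<bar> \<le> 2" for t
    proof -
      define z where "z = t\<^sup>2 / (2 * R\<^sup>2)"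
      have "z \<ge> 0" by (simp add: z_def)
      then have "\<bar>1 - 2 * z\<bar> \<le> 2 * exp z" using exp_ge_add_one_self[of z] by linarith
      then show ?thesis
        unfolding k_def z_def[symmetric] abs_mult by (simp add: exp_minus field_simps)
    qed
    have hR: "\<bar>h t\<bar> \<le> R" for t
    proof -
      have "0 \<le> (\<bar>t\<bar> / R - 1)\<^sup>2" by simp
      then have "\<bar>t\<bar> / R \<le> 1 + t\<^sup>2 / (2 * R\<^sup>2)"
        using R by (simp add: power2_diff power_divide)
      also have "\<dots> \<le> exp (t\<^sup>2 / (2 * R\<^sup>2))" by (rule exp_ge_add_one_self)
      finally show ?thesis using R unfolding h_def abs_mult by (simp add: exp_minus field_simps)
    qed
    have h_le: "\<bar>h t\<bar> \<le> \<bar>t\<bar>" for t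
      unfolding h_def abs_mult by (rule mult_left_le) auto
    let ?h = "\<lambda>i. h (s * of_int i)" and ?b = "\<lambda>i. drift P X i / s"
    have hb: "\<bar>?h i * ?b i\<bar> \<le> R * (M / s)" for i
      using hR[of "s * of_int i"] moment_bounds(1)[of i] s R
      unfolding abs_mult by (intro mult_mono) (auto simp: divide_right_mono)
    note int = integrable_D[OF hb] integrable_D[of ?h, OF hR]
    \<comment> \<open>Inside \<open>[- K, K]\<close> the drift may have the wrong sign, but there \<open>\<bar>h\<bar> \<le> K\<close> and the scaled drift is at most \<open>B\<close> in size.\<close>
    have pointwise: "c * \<bar>?h i\<bar> \<le> - (?h i * ?b i) + K * (B + c)" for i
    proof -
      let ?y = "s * of_int i"
      have KBc: "0 \<le> K * (B + c)" using K B c by simp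
      consider "\<bar>?y\<bar> \<le> K" | "?y > K" | "?y < - K" by linarith
      then show ?thesis
      proof cases
        case 1
        have "\<bar>?h i\<bar> * (\<bar>?b i\<bar> + c) \<le> K * (B + c)"
          using centre[OF 1] h_le[of ?y] 1 B c by (intro mult_mono) auto
        moreover have "?h i * ?b i \<le> \<bar>?h i\<bar> * \<bar>?b i\<bar>" by (metis abs_ge_self abs_mult)
        ultimately show ?thesis by (simp add: algebra_simps)
      next
        case 2
        then have "0 \<le> ?h i" using K by (auto simp: h_def)
        then have "?h i * ?b i \<le> ?h i * (- c)" using right[OF 2] by (intro mult_left_mono)
        then show ?thesis using \<open>0 \<le> ?h i\<close> KBc by (simp add: algebra_simps)
      next
        case 3
        then have "s * of_int i \<le> 0" using K by linarith
        then have "?h i \<le> 0" unfolding h_def by (rule mult_nonpos_nonneg) simp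
        then have "?h i * ?b i \<le> ?h i * c" using left[OF 3] by (intro mult_left_mono_neg)
        then show ?thesis using \<open>?h i \<le> 0\<close> KBc by (simp add: algebra_simps)
      qed
    qed
    have "c * (\<integral>i. \<bar>?h i\<bar> \<partial>D) = (\<integral>i. c * \<bar>?h i\<bar> \<partial>D)" by simp
    also have "\<dots> \<le> (\<integral>i. - (?h i * ?b i) + K * (B + c) \<partial>D)"
      by (intro integral_mono pointwise) (use int in auto)
    also have "\<dots> = - (\<integral>i. ?h i * ?b i \<partial>D) + K * (B + c)"
      using int by (simp add: D.prob_space)
    also have "\<dots> \<le> ?T"
      using first_order_balance[OF f bf h k s] by linarith
    finally have mean: "c * (\<integral>i. \<bar>?h i\<bar> \<partial>D) \<le> ?T" .
    let ?A = "{i. N \<le> \<bar>s * of_int i\<bar> \<and> \<bar>s * of_int i\<bar> \<le> R}"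
    have h_ge: "N / 2 * indicator ?A i \<le> \<bar>?h i\<bar>" for i
    proof (cases "i \<in> ?A")
      case True
      let ?y = "s * of_int i"
      have "?y\<^sup>2 \<le> R\<^sup>2" using True R by (simp add: abs_le_square_iff[symmetric] del: power_mult_distrib)
      then have z: "?y\<^sup>2 / (2 * R\<^sup>2) \<le> 1 / 2" using R by (simp add: field_simps)
      have "exp (?y\<^sup>2 / (2 * R\<^sup>2)) \<le> 2"
        using z exp_bound_half[of "?y\<^sup>2 / (2 * R\<^sup>2)"] by simp
      then have "1 / 2 \<le> exp (- (?y\<^sup>2 / (2 * R\<^sup>2)))" by (simp add: exp_minus field_simps)
      then have "N * (1 / 2) \<le> \<bar>?y\<bar> * exp (- (?y\<^sup>2 / (2 * R\<^sup>2)))"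
        using True N by (intro mult_mono) auto
      then show ?thesis using True by (simp add: h_def abs_mult)
    qed simp
    have "N / 2 * measure D ?A = (\<integral>i. N / 2 * indicator ?A i \<partial>D)" using sets_D by simp
    also have "\<dots> \<le> (\<integral>i. \<bar>?h i\<bar> \<partial>D)"
    proof (rule integral_mono[OF _ _ h_ge])
      show "integrable D (\<lambda>i. N / 2 * indicator ?A i)"
        by (rule integrable_D[of _ "N / 2"]) (use N in \<open>auto split: split_indicator\<close>)
    qed (use int in auto)
    finally have "N / 2 * measure D ?A * c \<le> ?T"
      using mean c by (smt (verit) mult.commute mult_left_mono)
    then show ?thesis using N c by (simp add: field_simps)
  qed
  let ?A = "\<lambda>n::nat. {i. N \<le> \<bar>s * of_int i\<bar> \<and> \<bar>s * of_int i\<bar> \<le> real (Suc n)}"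
  have "(\<lambda>n. measure D (?A n)) \<longlonglongrightarrow> measure D (\<Union>n. ?A n)"
    using sets_D by (intro D.finite_Lim_measure_incseq) (auto simp: incseq_def)
  moreover have "(\<Union>n. ?A n) = {i. N \<le> \<bar>s * of_int i\<bar>}"
  proof (intro set_eqI iffI)
    fix i assume "i \<in> {i. N \<le> \<bar>s * of_int i\<bar>}"
    moreover have "\<bar>s * of_int i\<bar> \<le> real (Suc (nat \<lceil>\<bar>s * of_int i\<bar>\<rceil>))" by linarith
    ultimately show "i \<in> (\<Union>n. ?A n)" by blast
  qed auto
  ultimately have "(\<lambda>n. measure D (?A n)) \<longlonglongrightarrow> measure D {i. N \<le> \<bar>s * of_int i\<bar>}" by simp
  then show ?thesis
    by (rule LIMSEQ_le_const2) (use bound in auto)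
qed

end

section \<open>Convergence of stationary walks to a Gibbs law\<close>

text \<open>
  A family of stationary walks, seen at the scale \<open>s\<close>, whose drift per unit of the scale
  tends to \<open>- v g / 2\<close> and whose variance tends to \<open>v\<close>, both uniformly on compact sets. These are
  the coefficients of the diffusion with Gibbs weight \<open>exp(- \<integral> g)\<close>. Far from the origin no limit is
  assumed, only a restoring drift; this is where clipped and unclipped rates differ.
\<close>

locale gibbs_scaling =
  fixes F :: "'i filter" and P :: "'i \<Rightarrow> 'w measure" and X :: "'i \<Rightarrow> int \<Rightarrow> 'w \<Rightarrow> int"
    and D :: "'i \<Rightarrow> int measure" and s :: "'i \<Rightarrow> real" and M v c K :: real and g :: "real \<Rightarrow> real"
  assumes walk: "\<forall>\<^sub>F \<eta> in F. stationary_walk (P \<eta>) (X \<eta>) (D \<eta>) M"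
    and scale_pos: "\<forall>\<^sub>F \<eta> in F. s \<eta> > 0" and scale_lim: "(s \<longlongrightarrow> 0) F"
    and M_nonneg: "M \<ge> 0" and v_pos: "v > 0" and c_pos: "c > 0" and K_nonneg: "K \<ge> 0"
    and g_continuous: "continuous_on UNIV g"
    and g_right: "\<And>t. t > K \<Longrightarrow> g t \<ge> c" and g_left: "\<And>t. t < - K \<Longrightarrow> g t \<le> - c"
    and local_limit: "\<And>R e. e > 0 \<Longrightarrow> \<forall>\<^sub>F \<eta> in F. \<forall>i. \<bar>s \<eta> * of_int i\<bar> \<le> R \<longrightarrow>
        \<bar>drift (P \<eta>) (X \<eta>) i / s \<eta> + v / 2 * g (s \<eta> * of_int i)\<bar> \<le> e \<and>
        \<bar>second_moment (P \<eta>) (X \<eta>) i - v\<bar> \<le> e"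
    and restoring: "\<forall>\<^sub>F \<eta> in F. \<forall>i.
        (s \<eta> * of_int i > K \<longrightarrow> drift (P \<eta>) (X \<eta>) i / s \<eta> \<le> - c) \<and>
        (s \<eta> * of_int i < - K \<longrightarrow> drift (P \<eta>) (X \<eta>) i / s \<eta> \<ge> c)"
begin

lemma normalizable: "gibbs_normalizable g"
  by (rule gibbs_normalizable_if_confining[OF g_continuous c_pos g_right g_left])

text \<open>
  For \<open>h, k\<close> solving the Poisson equation, the limiting generator is
  \<open>- v g h / 2 + v k / 2 = v u / 2\<close>. The second-order balance makes the stationary mean of
  the prelimit generator tend to 0, and as everything is supported in a fixed compact set the two
  differ by little.
\<close>

lemma centred_test_limit:
  fixes u :: "real \<Rightarrow> real"
  assumes u: "continuous_on UNIV u" and supp: "\<And>t. \<bar>t\<bar> > R \<Longrightarrow> u t = 0"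
    and centred: "(\<integral>t. u t * gibbs_weight g t \<partial>lborel) = 0"
  shows "((\<lambda>\<eta>. \<integral>i. u (s \<eta> * of_int i) \<partial>D \<eta>) \<longlongrightarrow> 0) F"
proof (rule tendstoI)
  fix e :: real assume "e > 0"
  obtain f h k where f: "\<And>t. (f has_real_derivative h t) (at t)"
    and h: "\<And>t. (h has_real_derivative k t) (at t)"
    and poisson: "\<And>t. k t - g t * h t = u t"
    and h0: "\<And>t. \<bar>t\<bar> > \<bar>R\<bar> \<Longrightarrow> h t = 0" and k0: "\<And>t. \<bar>t\<bar> > \<bar>R\<bar> \<Longrightarrow> k t = 0"
    and ch: "continuous_on UNIV h" and ck: "continuous_on UNIV k" and bf: "bounded (range f)"
    using gibbs_poisson_solution[OF g_continuous u supp centred] by blast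
  obtain Bh where Bh: "Bh > 0" "\<And>t. \<bar>h t\<bar> \<le> Bh" 
    using compact_support_bounded[OF ch h0] by blast
  obtain Bk where Bk: "Bk > 0" "\<And>t. \<bar>k t\<bar> \<le> Bk" 
    using compact_support_bounded[OF ck k0] by blast
  obtain Bu where Bu: "Bu > 0" "\<And>t. \<bar>u t\<bar> \<le> Bu" 
    using compact_support_bounded[OF u supp] by blast
  \<comment> \<open>The errors below add up to \<open>(M + Bh + Bk) e'\<close>, to be compared with \<open>v e / 2\<close>.\<close>
  define e' where "e' = e * v / (4 * (M + Bh + Bk))"
  have e': "e' > 0" using \<open>e > 0\<close> v_pos M_nonneg Bh Bk by (simp add: e'_def add_nonneg_pos)
  obtain C where C: "C \<ge> 0" "\<And>a b. \<bar>k a - k b\<bar> \<le> e' + C * \<bar>a - b\<bar>"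
    using compact_support_almost_lipschitz[OF ck k0 e'] by blast
  have "((\<lambda>\<eta>. C * s \<eta>) \<longlongrightarrow> 0) F" using tendsto_mult_left[OF scale_lim, of C] by simp
  then have small: "\<forall>\<^sub>F \<eta> in F. C * s \<eta> < e'" using e' by (rule order_tendstoD)
  show "\<forall>\<^sub>F \<eta> in F. dist (\<integral>i. u (s \<eta> * of_int i) \<partial>D \<eta>) 0 < e"
    using walk scale_pos small local_limit[OF e', of "\<bar>R\<bar>"]
  proof eventually_elim
    case (elim \<eta>)
    interpret stationary_walk "P \<eta>" "X \<eta>" "D \<eta>" M by (rule elim(1))
    let ?\<mu> = "drift (P \<eta>) (X \<eta>)" and ?m = "second_moment (P \<eta>) (X \<eta>)" and ?s = "s \<eta>"
    let ?L = "\<lambda>i. h (?s * of_int i) * (?\<mu> i / ?s) + k (?s * of_int i) * (?m i / 2)"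
    have L: "\<bar>?L i - v / 2 * u (?s * of_int i)\<bar> \<le> (Bh + Bk) * e'" for i
    proof (cases "\<bar>?s * of_int i\<bar> \<le> \<bar>R\<bar>")
      case True
      let ?y = "?s * of_int i"
      have k: "k ?y = u ?y + g ?y * h ?y" using poisson[of ?y] by simp
      have "?L i - v / 2 * u ?y = h ?y * (?\<mu> i / ?s + v / 2 * g ?y) + k ?y / 2 * (?m i - v)"
        unfolding k by (simp add: field_simps)
      also have "\<bar>\<dots>\<bar> \<le> \<bar>h ?y\<bar> * \<bar>?\<mu> i / ?s + v / 2 * g ?y\<bar> + \<bar>k ?y / 2\<bar> * \<bar>?m i - v\<bar>"
        unfolding abs_mult[symmetric] by (rule abs_triangle_ineq)
      also have "\<dots> \<le> Bh * e' + Bk * e'"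
      proof -
        have "\<bar>k ?y / 2\<bar> \<le> Bk" using Bk(1) Bk(2)[of ?y] by simp
        then show ?thesis using elim(4) True Bh Bk e' by (intro add_mono mult_mono) auto
      qed
      finally show ?thesis by (simp add: algebra_simps)
    next
      case False
      then have "h (?s * of_int i) = 0" "k (?s * of_int i) = 0" "u (?s * of_int i) = 0"
        using h0[of "?s * of_int i"] k0[of "?s * of_int i"] supp[of "?s * of_int i"] by auto
      then show ?thesis using Bh Bk e' by simp
    qed
    have Lb: "\<bar>?L i\<bar> \<le> (Bh + Bk) * e' + v / 2 * Bu" for i
    proof -
      have "\<bar>v / 2 * u (?s * of_int i)\<bar> \<le> v / 2 * Bu"
        unfolding abs_mult using v_pos Bu by (intro mult_mono) auto
      then show ?thesis using L[of i] by linarith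
    qed
    note int = integrable_D[OF Lb] integrable_D[of "\<lambda>i. u (?s * of_int i)", OF Bu(2)]
    have "\<bar>(\<integral>i. ?L i \<partial>D \<eta>) - v / 2 * (\<integral>i. u (?s * of_int i) \<partial>D \<eta>)\<bar>
        = \<bar>\<integral>i. ?L i - v / 2 * u (?s * of_int i) \<partial>D \<eta>\<bar>"
      using int by simp
    also have "\<dots> \<le> (\<integral>i. \<bar>?L i - v / 2 * u (?s * of_int i)\<bar> \<partial>D \<eta>)" by (rule integral_abs_bound)
    also have "\<dots> \<le> (\<integral>i. (Bh + Bk) * e' \<partial>D \<eta>)"
      by (rule integral_mono) (use int L in auto)
    finally have 1: "\<bar>(\<integral>i. ?L i \<partial>D \<eta>) - v / 2 * (\<integral>i. u (?s * of_int i) \<partial>D \<eta>)\<bar> \<le> (Bh + Bk) * e'"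
      by (simp add: D.prob_space)
    have "\<bar>\<integral>i. ?L i \<partial>D \<eta>\<bar> \<le> (e' + C * ?s) * M / 2"
      by (rule second_order_balance[OF f bf h C(2) _ C(1) elim(2)]) (use e' in simp)
    also have "\<dots> \<le> (e' + e') * M / 2"
      using elim(3) M_nonneg by (intro divide_right_mono mult_right_mono) auto
    finally have "v / 2 * \<bar>\<integral>i. u (?s * of_int i) \<partial>D \<eta>\<bar> \<le> (M + Bh + Bk) * e'"
      using 1 v_pos by (simp add: abs_mult algebra_simps flip: abs_mult_pos')
    also have "\<dots> < v / 2 * e"
    proof -
      have "(M + Bh + Bk) * e' = e * v / 4"
        using Bh Bk M_nonneg by (simp add: e'_def field_simps add_nonneg_eq_0_iff)
      then show ?thesis using mult_pos_pos[OF v_pos \<open>e > 0\<close>] by (simp add: mult.commute)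
    qed
    finally show "dist (\<integral>i. u (?s * of_int i) \<partial>D \<eta>) 0 < e" using v_pos by simp
  qed
qed

lemma tight:
  obtains T where "T \<ge> 0"
    "\<forall>\<^sub>F \<eta> in F. \<forall>N>0. measure (D \<eta>) {i. N \<le> \<bar>s \<eta> * of_int i\<bar>} \<le> T / N"
proof -
  have "compact (g ` {-K..K})"
    by (intro compact_continuous_image continuous_on_subset[OF g_continuous]) auto
  then obtain G where G: "G > 0" "\<forall>x\<in>g ` {-K..K}. norm x \<le> G"
    using compact_imp_bounded bounded_pos by metis
  define B where "B = 1 + v / 2 * G"
  have B: "B \<ge> 0" using G v_pos by (simp add: B_def)
  show ?thesis
  proof (rule that[of "2 * (M + K * (B + c)) / c"])
    show "0 \<le> 2 * (M + K * (B + c)) / c" using M_nonneg K_nonneg B c_pos by simp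
    show "\<forall>\<^sub>F \<eta> in F. \<forall>N>0. measure (D \<eta>) {i. N \<le> \<bar>s \<eta> * of_int i\<bar>} \<le> 2 * (M + K * (B + c)) / c / N"
      using walk scale_pos restoring local_limit[OF zero_less_one, of K]
    proof eventually_elim
      case (elim \<eta>)
      interpret stationary_walk "P \<eta>" "X \<eta>" "D \<eta>" M by (rule elim(1))
      have "\<bar>drift (P \<eta>) (X \<eta>) i / s \<eta>\<bar> \<le> B" if y: "\<bar>s \<eta> * of_int i\<bar> \<le> K" for i
      proof -
        have "\<bar>g (s \<eta> * of_int i)\<bar> \<le> G" using G(2) y by (auto simp: abs_le_iff)
        then have "\<bar>v / 2 * g (s \<eta> * of_int i)\<bar> \<le> v / 2 * G"
          unfolding abs_mult using v_pos by (intro mult_mono) auto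
        moreover have "\<bar>drift (P \<eta>) (X \<eta>) i / s \<eta> + v / 2 * g (s \<eta> * of_int i)\<bar> \<le> 1"
          using elim(4) y by blast
        ultimately show ?thesis unfolding B_def by linarith
      qed
      then show ?case
        using elim(2,3) by (intro allI impI tail_bound c_pos K_nonneg B) auto
    qed
  qed
qed

text \<open>
  Reduction to centred test functions: with a cut-off \<open>cut n\<close> equal to 1 on
  \<open>[- n, n]\<close> and \<open>m n\<close> the Gibbs mean of \<open>u\<close> weighted by it, the function
  \<open>(u - m n) cut n\<close> has compact support and Gibbs mean zero. So its stationary mean tends to 0, while by
  tightness it differs from \<open>u - m n\<close> by little. Since \<open>m n\<close> converges to the Gibbs mean of
  \<open>u\<close>, this identifies the limit without extracting convergent subsequences.
\<close>

lemma gibbs_limit_of_means: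
  fixes u :: "real \<Rightarrow> real"
  assumes u: "continuous_on UNIV u" and u1: "\<And>t. \<bar>u t\<bar> \<le> 1"
  shows "((\<lambda>\<eta>. \<integral>i. u (s \<eta> * of_int i) \<partial>D \<eta>) \<longlongrightarrow> (\<integral>t. u t \<partial>Gibbs g)) F"
proof (rule tendstoI)
  fix e :: real assume e: "e > 0"
  let ?w = "gibbs_weight g"
  define cut where "cut n t = max 0 (min 1 (real n + 1 - \<bar>t\<bar>))" for n :: nat and t :: real
  have cut: "continuous_on UNIV (cut n)" "0 \<le> cut n t" "cut n t \<le> 1" "\<bar>t\<bar> \<le> n \<Longrightarrow> cut n t = 1"
    "\<bar>t\<bar> > real n + 1 \<Longrightarrow> cut n t = 0" for n t
    by (auto simp: cut_def[abs_def] intro!: continuous_intros)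
  have w: "integrable lborel ?w" using normalizable by (simp add: gibbs_normalizable_def)
  have wm [measurable]: "?w \<in> borel_measurable borel" by (rule gibbs_weight_measurable[OF g_continuous])
  have cutm [measurable]: "cut n \<in> borel_measurable borel" for n
    by (rule borel_measurable_continuous_onI[OF cut(1)])
  have um [measurable]: "u \<in> borel_measurable borel"
    by (rule borel_measurable_continuous_onI[OF u])
  have cut_lim: "(\<lambda>n. cut n t) \<longlonglongrightarrow> 1" for t
  proof (rule tendsto_eventually)
    show "\<forall>\<^sub>F n in sequentially. cut n t = 1"
      using eventually_ge_at_top[of "nat \<lceil>\<bar>t\<bar>\<rceil>"] by eventually_elim (rule cut(4), linarith)
  qed
  have dom: "integrable lborel (\<lambda>t. a t * cut n t * ?w t)"
      "(\<lambda>n. \<integral>t. a t * cut n t * ?w t \<partial>lborel) \<longlonglongrightarrow> (\<integral>t. a t * ?w t \<partial>lborel)"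
    if a [measurable]: "a \<in> borel_measurable borel" and a1: "\<And>t. \<bar>a t\<bar> \<le> 1" for a :: "real \<Rightarrow> real" and n
  proof -
    have b: "\<bar>a t * cut n t * ?w t\<bar> \<le> ?w t" for t n
    proof -
      have "\<bar>a t\<bar> * \<bar>cut n t\<bar> \<le> 1 * 1" using a1 cut(2,3)[of n t] by (intro mult_mono) auto
      then show ?thesis
        unfolding abs_mult using gibbs_weight_pos[of g t] by (simp add: mult_left_le_one_le)
    qed
    show "integrable lborel (\<lambda>t. a t * cut n t * ?w t)"
      by (rule Bochner_Integration.integrable_bound[OF w]) (use b in \<open>auto intro: order_trans[OF _ abs_ge_self]\<close>)
    show "(\<lambda>n. \<integral>t. a t * cut n t * ?w t \<partial>lborel) \<longlonglongrightarrow> (\<integral>t. a t * ?w t \<partial>lborel)"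
    proof (rule integral_dominated_convergence[where w = ?w])
      have "(\<lambda>n. a t * cut n t * ?w t) \<longlonglongrightarrow> a t * 1 * ?w t" for t
        by (intro tendsto_intros cut_lim)
      then show "AE t in lborel. (\<lambda>n. a t * cut n t * ?w t) \<longlonglongrightarrow> a t * ?w t" by simp
    qed (use w b in auto)
  qed
  define Z where "Z n = (\<integral>t. 1 * cut n t * ?w t \<partial>lborel)" for n
  define m where "m n = (\<integral>t. u t * cut n t * ?w t \<partial>lborel) / Z n" for n
  have "Z \<longlonglongrightarrow> (\<integral>t. ?w t \<partial>lborel)"
    using dom(2)[of "\<lambda>_. 1"] by (simp add: Z_def[abs_def])
  then have Z: "\<forall>\<^sub>F n in sequentially. Z n > 0"
    using gibbs_partition_pos[OF g_continuous normalizable] by (rule order_tendstoD)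
  have m_lim: "m \<longlonglongrightarrow> (\<integral>t. u t \<partial>Gibbs g)"
    unfolding integral_Gibbs[OF g_continuous normalizable um] m_def[abs_def] Z_def
    using dom(2)[OF um u1] dom(2)[of "\<lambda>_. 1"] gibbs_partition_pos[OF g_continuous normalizable]
    by (intro tendsto_divide) auto
  have m1: "\<bar>m n\<bar> \<le> 1" if Z: "Z n > 0" for n
  proof -
    have "\<bar>\<integral>t. u t * cut n t * ?w t \<partial>lborel\<bar> \<le> (\<integral>t. \<bar>u t * cut n t * ?w t\<bar> \<partial>lborel)"
      by (rule integral_abs_bound)
    also have "\<dots> \<le> Z n"
      unfolding Z_def
    proof (rule integral_mono)
      show "\<bar>u t * cut n t * ?w t\<bar> \<le> 1 * cut n t * ?w t" for t
        unfolding abs_mult using u1 cut(2)[of n t] gibbs_weight_pos[of g t]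
        by (intro mult_mono) auto
    qed (use dom(1)[OF um u1, of n] dom(1)[of "\<lambda>_. 1" n] in \<open>auto intro: integrable_abs\<close>)
    finally show ?thesis using Z by (simp add: m_def)
  qed
  obtain T where T: "T \<ge> 0"
    and tail: "\<forall>\<^sub>F \<eta> in F. \<forall>N>0. measure (D \<eta>) {i. N \<le> \<bar>s \<eta> * of_int i\<bar>} \<le> T / N"
    by (rule tight)
  have "(\<lambda>n. 2 * T / real n) \<longlonglongrightarrow> 0" by (rule lim_const_over_n)
  then have "\<forall>\<^sub>F n in sequentially. 2 * T / real n < e / 3"
    using e by (intro order_tendstoD) auto
  moreover have "\<forall>\<^sub>F n in sequentially. dist (m n) (\<integral>t. u t \<partial>Gibbs g) < e / 3"
    using e by (intro tendstoD[OF m_lim]) simp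
  ultimately have "\<forall>\<^sub>F n in sequentially. 2 * T / real n < e / 3 \<and>
      dist (m n) (\<integral>t. u t \<partial>Gibbs g) < e / 3 \<and> n > 0 \<and> Z n > 0"
    using Z eventually_gt_at_top[of 0] by eventually_elim simp
  then obtain n where n: "2 * T / real n < e / 3" "dist (m n) (\<integral>t. u t \<partial>Gibbs g) < e / 3" "n > 0" "Z n > 0"
    by (auto dest: eventually_happens)
  define a where "a t = (u t - m n) * cut n t" for t
  have "((\<lambda>\<eta>. \<integral>i. a (s \<eta> * of_int i) \<partial>D \<eta>) \<longlongrightarrow> 0) F"
  proof (rule centred_test_limit[where R = "real n + 1"])
    show "continuous_on UNIV a" unfolding a_def[abs_def] by (intro continuous_intros u cut(1))
    show "a t = 0" if "\<bar>t\<bar> > real n + 1" for t using cut(5)[OF that] by (simp add: a_def)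
    have "(\<integral>t. a t * ?w t \<partial>lborel) = (\<integral>t. u t * cut n t * ?w t - m n * (1 * cut n t * ?w t) \<partial>lborel)"
      by (intro Bochner_Integration.integral_cong) (auto simp: a_def algebra_simps)
    also have "\<dots> = (\<integral>t. u t * cut n t * ?w t \<partial>lborel) - m n * Z n"
      using dom(1)[OF um u1, of n] dom(1)[of "\<lambda>_. 1" n] by (simp add: Z_def)
    finally show "(\<integral>t. a t * ?w t \<partial>lborel) = 0" using n(4) by (simp add: m_def)
  qed
  then have "\<forall>\<^sub>F \<eta> in F. dist (\<integral>i. a (s \<eta> * of_int i) \<partial>D \<eta>) 0 < e / 3"
    using e by (intro tendstoD) auto
  with walk tail show "\<forall>\<^sub>F \<eta> in F. dist (\<integral>i. u (s \<eta> * of_int i) \<partial>D \<eta>) (\<integral>t. u t \<partial>Gibbs g) < e"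
  proof eventually_elim
    case (elim \<eta>)
    interpret stationary_walk "P \<eta>" "X \<eta>" "D \<eta>" M by (rule elim(1))
    let ?A = "{i. real n \<le> \<bar>s \<eta> * of_int i\<bar>}"
    have um1: "\<bar>u t - m n\<bar> \<le> 2" for t using u1[of t] m1[OF n(4)] by linarith
    have a2: "\<bar>a t\<bar> \<le> 2" for t
    proof -
      have "\<bar>u t - m n\<bar> * \<bar>cut n t\<bar> \<le> 2 * 1" using um1 cut(2,3)[of n t] by (intro mult_mono) auto
      then show ?thesis by (simp add: a_def abs_mult)
    qed
    note int = integrable_D[of "\<lambda>i. u (s \<eta> * of_int i)", OF u1]
      integrable_D[of "\<lambda>i. a (s \<eta> * of_int i)", OF a2]
    have tail_a: "\<bar>u (s \<eta> * of_int i) - m n - a (s \<eta> * of_int i)\<bar> \<le> 2 * indicator ?A i" for i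
    proof (cases "i \<in> ?A")
      case True
      let ?t = "s \<eta> * of_int i"
      have "u ?t - m n - a ?t = (u ?t - m n) * (1 - cut n ?t)" by (simp add: a_def algebra_simps)
      moreover have "\<bar>u ?t - m n\<bar> * \<bar>1 - cut n ?t\<bar> \<le> 2 * 1"
        using um1 cut(2,3)[of n ?t] by (intro mult_mono) auto
      ultimately show ?thesis using True by (simp add: abs_mult)
    next
      case False
      then show ?thesis using cut(4)[of "s \<eta> * of_int i" n] by (simp add: a_def)
    qed
    have "\<bar>(\<integral>i. u (s \<eta> * of_int i) \<partial>D \<eta>) - m n - (\<integral>i. a (s \<eta> * of_int i) \<partial>D \<eta>)\<bar>
        = \<bar>\<integral>i. u (s \<eta> * of_int i) - m n - a (s \<eta> * of_int i) \<partial>D \<eta>\<bar>"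
      using int by (simp add: D.prob_space)
    also have "\<dots> \<le> (\<integral>i. \<bar>u (s \<eta> * of_int i) - m n - a (s \<eta> * of_int i)\<bar> \<partial>D \<eta>)"
      by (rule integral_abs_bound)
    also have "\<dots> \<le> (\<integral>i. 2 * indicator ?A i \<partial>D \<eta>)"
    proof (rule integral_mono[OF _ _ tail_a])
      show "integrable (D \<eta>) (\<lambda>i. 2 * indicator ?A i :: real)"
        by (rule integrable_D[of _ 2]) (auto split: split_indicator)
    qed (use int in auto)
    also have "\<dots> = 2 * measure (D \<eta>) ?A" using sets_D by simp
    also have "\<dots> \<le> 2 * T / real n" using elim(2)[rule_format, of "real n"] n(3) by (simp add: field_simps)
    finally show ?case using n(1,2) elim(3) unfolding dist_real_def by linarith
  qed
qed

theorem scaled_stationary_weak_limit: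
  "weak_conv_along F (\<lambda>\<eta>. distr (D \<eta>) borel (\<lambda>i. s \<eta> * of_int i)) (Gibbs g)"
proof (rule weak_conv_along_cts_stepI)
  show "real_distribution (Gibbs g)" by (rule real_distribution_Gibbs[OF g_continuous normalizable])
  show "\<forall>\<^sub>F \<eta> in F. real_distribution (distr (D \<eta>) borel (\<lambda>i. s \<eta> * of_int i))"
    using walk
  proof eventually_elim
    case (elim \<eta>)
    interpret stationary_walk "P \<eta>" "X \<eta>" "D \<eta>" M by (rule elim)
    show ?case by (intro D.real_distribution_distr) simp
  qed
  fix x y :: real assume xy: "x < y"
  have c: "continuous_on UNIV (cts_step x y)"
    by (rule uniformly_continuous_imp_continuous[OF cts_step_uniformly_continuous[OF xy]])
  have "((\<lambda>\<eta>. \<integral>i. cts_step x y (s \<eta> * of_int i) \<partial>D \<eta>) \<longlongrightarrow> (\<integral>t. cts_step x y t \<partial>Gibbs g)) F"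
    by (rule gibbs_limit_of_means[OF c]) (use xy in \<open>auto simp: cts_step_def\<close>)
  moreover have "\<forall>\<^sub>F \<eta> in F. (\<integral>t. cts_step x y t \<partial>distr (D \<eta>) borel (\<lambda>i. s \<eta> * of_int i))
      = (\<integral>i. cts_step x y (s \<eta> * of_int i) \<partial>D \<eta>)"
    using walk
  proof eventually_elim
    case (elim \<eta>)
    interpret stationary_walk "P \<eta>" "X \<eta>" "D \<eta>" M by (rule elim)
    show ?case
      by (rule integral_distr) (simp, rule borel_measurable_continuous_onI[OF c])
  qed
  ultimately show "((\<lambda>\<eta>. \<integral>t. cts_step x y t \<partial>distr (D \<eta>) borel (\<lambda>i. s \<eta> * of_int i))
      \<longlongrightarrow> (\<integral>t. cts_step x y t \<partial>Gibbs g)) F"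
    by (subst tendsto_cong)
qed

end

section \<open>The queue as a stationary walk\<close>

lemma nn_integral_count_space_has_sum:
  fixes f :: "'a \<Rightarrow> real"
  assumes "(f has_sum S) A" "\<And>x. x \<in> A \<Longrightarrow> f x \<ge> 0"
  shows "(\<integral>\<^sup>+x. ennreal (f x) \<partial>count_space A) = ennreal S"
proof -
  have "(\<lambda>x. norm (f x)) summable_on A"
    using has_sum_imp_summable[OF assms(1)] summable_on_iff_abs_summable_on_real by blast
  then have "Infinite_Set_Sum.abs_summable_on f A" by (rule abs_summable_equivalent[THEN iffD1])
  then show ?thesis
    using assms infsumI[OF assms(1)] by (simp add: nn_integral_conv_infsetsum infsetsum_infsum)
qed

text \<open>
  Invariance of the point probabilities says that a stationary state followed by one
  independent transition has the law \<open>D\<close> again. Fubini turns this into the statement about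
  bounded functions.
\<close>

lemma stationary_distribution_mean:
  fixes X :: "'s::countable \<Rightarrow> nat \<Rightarrow> 'w \<Rightarrow> 's" and f :: "'s \<Rightarrow> real"
  assumes P: "prob_space P" and D: "stationary_distribution P X D"
    and X: "\<And>i. X i 1 \<in> measurable P (count_space UNIV)"
    and f: "bounded (range f)"
  shows "(\<integral>i. (\<integral>w. f (X i 1 w) \<partial>P) \<partial>D) = (\<integral>i. f i \<partial>D)"
proof -
  have sD: "sets D = sets (count_space UNIV)" and pD: "prob_space D"
    and inv: "\<And>j. ((\<lambda>i. measure D {i} * trans_prob P X 1 i j) has_sum measure D {j}) UNIV"
    using D by (auto simp: stationary_distribution_def)
  interpret P: prob_space P by (rule P)
  interpret D: prob_space D by (rule pD)
  interpret DP: pair_prob_space D P ..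
  have spD: "space D = UNIV" using sets_eq_imp_space_eq[OF sD] by simp
  have mD: "g \<in> borel_measurable D" for g :: "'s \<Rightarrow> ennreal"
    using spD sD by (auto simp: measurable_def)
  have density: "D = density (count_space UNIV) (\<lambda>i. emeasure D {i})"
    by (rule measure_eqI_countable[of _ UNIV]) (use sD in \<open>auto simp: emeasure_density\<close>)
  let ?step = "\<lambda>(i, w). X i 1 w"
  have step: "?step \<in> measurable (D \<Otimes>\<^sub>M P) (count_space UNIV)"
  proof -
    have "?step \<in> measurable (count_space UNIV \<Otimes>\<^sub>M P) (count_space UNIV)"
      by (rule measurable_pair_measure_countable1) (simp, simp only: prod.case X)
    then show ?thesis
      by (simp add: measurable_cong_sets[OF sets_pair_measure_cong[OF sD refl] refl])
  qed
  have "distr (D \<Otimes>\<^sub>M P) (count_space UNIV) ?step = D"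
  proof (rule measure_eqI_countable[of _ UNIV])
    fix j :: 's
    have "emeasure (distr (D \<Otimes>\<^sub>M P) (count_space UNIV) ?step) {j}
        = emeasure (D \<Otimes>\<^sub>M P) (?step -` {j} \<inter> space (D \<Otimes>\<^sub>M P))"
      by (rule emeasure_distr[OF step]) simp
    also have "\<dots> = (\<integral>\<^sup>+i. emeasure P (Pair i -` (?step -` {j} \<inter> space (D \<Otimes>\<^sub>M P))) \<partial>D)"
      by (rule P.emeasure_pair_measure_alt) (rule measurable_sets[OF step], simp)
    also have "\<dots> = (\<integral>\<^sup>+i. ennreal (trans_prob P X 1 i j) \<partial>D)"
    proof (rule nn_integral_cong)
      fix i
      have "Pair i -` (?step -` {j} \<inter> space (D \<Otimes>\<^sub>M P)) = {w \<in> space P. X i 1 w = j}"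
        by (auto simp: space_pair_measure spD)
      then show "emeasure P (Pair i -` (?step -` {j} \<inter> space (D \<Otimes>\<^sub>M P))) = ennreal (trans_prob P X 1 i j)"
        by (simp add: trans_prob_def P.emeasure_eq_measure)
    qed
    also have "\<dots> = (\<integral>\<^sup>+i. emeasure D {i} * ennreal (trans_prob P X 1 i j) \<partial>count_space UNIV)"
      by (subst density, rule nn_integral_density) auto
    also have "\<dots> = (\<integral>\<^sup>+i. ennreal (measure D {i} * trans_prob P X 1 i j) \<partial>count_space UNIV)"
      by (simp add: D.emeasure_eq_measure ennreal_mult trans_prob_def)
    also have "\<dots> = emeasure D {j}"
      by (subst nn_integral_count_space_has_sum[OF inv])
         (auto simp: D.emeasure_eq_measure trans_prob_def)
    finally show "emeasure (distr (D \<Otimes>\<^sub>M P) (count_space UNIV) ?step) {j} = emeasure D {j}" .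
  qed (use sD in auto)
  then have "(\<integral>i. f i \<partial>D) = (\<integral>i. f i \<partial>distr (D \<Otimes>\<^sub>M P) (count_space UNIV) ?step)" by simp
  also have "\<dots> = (\<integral>z. f (?step z) \<partial>(D \<Otimes>\<^sub>M P))"
    by (rule integral_distr[OF step]) simp
  also have "\<dots> = (\<integral>i. (\<integral>w. f (X i 1 w) \<partial>P) \<partial>D)"
  proof -
    obtain B where "\<And>i. \<bar>f i\<bar> \<le> B" using f by (auto simp: bounded_iff)
    then have "integrable (D \<Otimes>\<^sub>M P) (\<lambda>z. f (?step z))"
      by (intro DP.P.integrable_const_bound[of _ B] measurable_compose[OF step]) auto
    from DP.integral_fst'[OF this] show ?thesis by simp
  qed
  finally show ?thesis by simp
qed

context matching_queue
begin

definition step :: "int \<Rightarrow> 'w \<Rightarrow> int" where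
  "step i w = int (arrc i 0 w) - int (arrs i 0 w)"

lemma imbalance_one: "imbalance arrc arrs i 1 w = i + step i w"
  by (simp add: step_def)

lemma arrivals_measurable [measurable]:
  "arrc z k \<in> measurable P (count_space UNIV)" "arrs z k \<in> measurable P (count_space UNIV)"
proof -
  have "case_sum (\<lambda>(z, k). arrc z k) (\<lambda>(z, k). arrs z k) x \<in> measurable P (count_space UNIV)" for x
    using independent by (simp add: indep_vars_def)
  from this[of "Inl (z, k)"] this[of "Inr (z, k)"]
  show "arrc z k \<in> measurable P (count_space UNIV)" "arrs z k \<in> measurable P (count_space UNIV)"
    by simp_all
qed

lemma step_measurable [measurable]: "step i \<in> measurable P (count_space UNIV)"
proof -
  have "(\<lambda>w. (\<lambda>(a, b). int a - int b) (arrc i 0 w, arrs i 0 w)) \<in> measurable P (count_space UNIV)"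
    by (rule measurable_compose[OF measurable_Pair[OF arrivals_measurable]])
       (simp add: pair_measure_countable)
  then show ?thesis by (simp add: step_def[abs_def])
qed

lemma integrable_arrivals:
  "integrable P (\<lambda>w. real (arrc z k w))" "integrable P (\<lambda>w. (real (arrc z k w))\<^sup>2)"
  "integrable P (\<lambda>w. real (arrs z k w))" "integrable P (\<lambda>w. (real (arrs z k w))\<^sup>2)"
proof -
  have cube: "real n \<le> real n ^ 3" "(real n)\<^sup>2 \<le> real n ^ 3" for n
    using integer_powers_le_cube[of "int n"] by simp_all
  note c = Bochner_Integration.integrable_bound[OF third_integrable_c[of z k]]
    and s = Bochner_Integration.integrable_bound[OF third_integrable_s[of z k]]
  show "integrable P (\<lambda>w. real (arrc z k w))" "integrable P (\<lambda>w. (real (arrc z k w))\<^sup>2)"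
    by (rule c; use cube in simp)+
  show "integrable P (\<lambda>w. real (arrs z k w))" "integrable P (\<lambda>w. (real (arrs z k w))\<^sup>2)"
    by (rule s; use cube in simp)+
qed

lemma expectation_arrival_product:
  "integrable P (\<lambda>w. real (arrc z k w) * real (arrs z k w))"
  "expectation (\<lambda>w. real (arrc z k w) * real (arrs z k w)) = lam z * mu z"
proof -
  let ?A = "case_sum (\<lambda>(z, k). arrc z k) (\<lambda>(z, k). arrs z k)" and ?I = "{Inl (z, k), Inr (z, k)}"
  have ind: "indep_vars (\<lambda>_. borel) (\<lambda>j w. real (?A j w)) ?I"
    by (rule indep_vars_compose2[OF indep_vars_subset[OF independent subset_UNIV]]) simp
  have int: "integrable P (\<lambda>w. real (?A j w))" if "j \<in> ?I" for j
    using that integrable_arrivals by auto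
  show "integrable P (\<lambda>w. real (arrc z k w) * real (arrs z k w))"
    using indep_vars_integrable[OF _ ind int] by simp
  show "expectation (\<lambda>w. real (arrc z k w) * real (arrs z k w)) = lam z * mu z"
    using indep_vars_lebesgue_integral[OF _ ind int] by (simp add: mean_c mean_s)
qed

lemma drift_step: "drift P step i = lam i - mu i"
  using integrable_arrivals by (simp add: drift_def step_def mean_c mean_s)

lemma second_moment_step:
  "second_moment P step i = sigc (lam i) + sigs (mu i) + (lam i - mu i)\<^sup>2"
proof -
  let ?a = "\<lambda>w. real (arrc i 0 w)" and ?b = "\<lambda>w. real (arrs i 0 w)"
  have c: "expectation (\<lambda>w. (?a w)\<^sup>2) = sigc (lam i) + (lam i)\<^sup>2"
    using variance_c[of i 0] variance_eq[OF integrable_arrivals(1,2), of i 0] by (simp add: mean_c)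
  have s: "expectation (\<lambda>w. (?b w)\<^sup>2) = sigs (mu i) + (mu i)\<^sup>2"
    using variance_s[of i 0] variance_eq[OF integrable_arrivals(3,4), of i 0] by (simp add: mean_s)
  have "second_moment P step i = expectation (\<lambda>w. (?a w)\<^sup>2 + (?b w)\<^sup>2 - 2 * (?a w * ?b w))"
    unfolding second_moment_def step_def
    by (intro Bochner_Integration.integral_cong) (auto simp: power2_eq_square algebra_simps)
  also have "\<dots> = expectation (\<lambda>w. (?a w)\<^sup>2) + expectation (\<lambda>w. (?b w)\<^sup>2) - 2 * (lam i * mu i)"
    using integrable_arrivals expectation_arrival_product by simp
  finally show ?thesis unfolding c s by (simp add: power2_eq_square algebra_simps)
qed

lemma stationary_walk_step:
  assumes "stationary_distribution P (imbalance arrc arrs) D"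
  shows "stationary_walk P step D (2 * M)"
proof -
  have cube: "\<bar>real_of_int (step i w)\<bar> ^ 3 \<le> real (arrc i 0 w) ^ 3 + real (arrs i 0 w) ^ 3" for i w
  proof -
    have "\<bar>real_of_int (step i w)\<bar> \<le> max (real (arrc i 0 w)) (real (arrs i 0 w))"
      by (auto simp: step_def)
    then have "\<bar>real_of_int (step i w)\<bar> ^ 3 \<le> max (real (arrc i 0 w)) (real (arrs i 0 w)) ^ 3"
      by (rule power_mono) simp
    also have "\<dots> \<le> real (arrc i 0 w) ^ 3 + real (arrs i 0 w) ^ 3" by (simp add: max_def)
    finally show ?thesis .
  qed
  have int_sum: "integrable P (\<lambda>w. real (arrc i 0 w) ^ 3 + real (arrs i 0 w) ^ 3)" for i
    by (intro Bochner_Integration.integrable_add third_integrable_c third_integrable_s)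
  have m: "(\<lambda>w. \<bar>real_of_int (step i w)\<bar> ^ 3) \<in> borel_measurable P" for i
    by (rule measurable_compose[OF step_measurable]) simp
  have int: "integrable P (\<lambda>w. \<bar>real_of_int (step i w)\<bar> ^ 3)" for i
    by (rule Bochner_Integration.integrable_bound[OF int_sum[of i] m]) (use cube in auto)
  have imb: "imbalance arrc arrs i 1 \<in> measurable P (count_space UNIV)" for i
  proof -
    have "imbalance arrc arrs i 1 = (\<lambda>w. i + step i w)" by (rule ext) (rule imbalance_one)
    then show ?thesis by (simp only:) (rule measurable_compose[OF step_measurable], simp)
  qed
  show ?thesis
  proof (intro stationary_walk.intro stationary_walk_axioms.intro prob_space_axioms)
    fix i
    have "expectation (\<lambda>w. \<bar>real_of_int (step i w)\<bar> ^ 3)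
        \<le> expectation (\<lambda>w. real (arrc i 0 w) ^ 3 + real (arrs i 0 w) ^ 3)"
      by (rule integral_mono[OF int int_sum cube])
    also have "\<dots> \<le> 2 * M"
      using third_integrable_c third_integrable_s third_moment_c[of i 0] third_moment_s[of i 0] by simp
    finally show "expectation (\<lambda>w. \<bar>real_of_int (step i w)\<bar> ^ 3) \<le> 2 * M" .
  next
    show "prob_space D" "sets D = UNIV" using assms by (auto simp: stationary_distribution_def)
  next
    fix f :: "int \<Rightarrow> real" assume "bounded (range f)"
    then show "(\<integral>i. expectation (\<lambda>w. f (i + step i w)) \<partial>D) = (\<integral>i. f i \<partial>D)"
      using stationary_distribution_mean[OF prob_space_axioms assms imb] by (simp only: imbalance_one)
  qed (rule int step_measurable)+
qed

end

section \<open>Scaling limits of the controlled rates\<close>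

lemma clip_inactive: "xmin \<le> x \<Longrightarrow> x \<le> xmax \<Longrightarrow> clip x xmax xmin = x"
  by (simp add: clip_def)

text \<open>
  Clipping does not destroy a restoring drift. Each rate can be moved by at most \<open>b\<close> in
  the direction that weakens the drift, so its weakening side is never clipped. If the other side is
  clipped, the rate sits at an end of its interval, and the remaining distance to the other rate is
  still at least \<open>d\<close>.
\<close>

lemma clipped_drift_le:
  assumes "p - q \<le> - d" "p \<le> b" "- q \<le> b" "d \<ge> 0" "b \<ge> 0"
    and "b + d \<le> lmax - a" "b + d \<le> a - lmin" "b + d \<le> mmax - a" "b + d \<le> a - mmin"
  shows "clip (a + p) lmax lmin - clip (a + q) mmax mmin \<le> - d"
  using assms by (auto simp: clip_def max_def min_def)

text \<open>
  The queues along an arbitrary filter, with common base rate \<open>a\<close>. \<open>D\<close> collects the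
  stationary laws.
\<close>

locale queue_family =
  fixes F :: "'i filter" and lmax lmin mmax mmin M a :: real
    and sigc sigs phic phis :: "real \<Rightarrow> real" and \<epsilon> \<tau> :: "'i \<Rightarrow> real"
    and P :: "'i \<Rightarrow> 'w measure" and arrc arrs :: "'i \<Rightarrow> int \<Rightarrow> nat \<Rightarrow> 'w \<Rightarrow> nat"
    and D :: "'i \<Rightarrow> int measure"
  assumes M_nonneg: "M \<ge> 0"
    and rate_gaps: "lmin < a" "a < lmax" "mmin < a" "a < mmax"
    and sig_continuous: "isCont sigc a" "isCont sigs a"
    and variance_pos: "sigc a + sigs a > 0"
    and phi_continuous: "continuous_on UNIV phic" "continuous_on UNIV phis"
    and confining: "negative_drift phic phis"
    and eps_pos: "\<forall>\<^sub>F \<eta> in F. \<epsilon> \<eta> > 0" and tau_pos: "\<forall>\<^sub>F \<eta> in F. \<tau> \<eta> > 0"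
    and eps_lim: "(\<epsilon> \<longlongrightarrow> 0) F"
    and queue: "\<forall>\<^sub>F \<eta> in F. matching_queue (P \<eta>) (arrc \<eta>) (arrs \<eta>)
           (controlled_rate a (\<epsilon> \<eta>) (\<tau> \<eta>) phic lmax lmin)
           (controlled_rate a (\<epsilon> \<eta>) (\<tau> \<eta>) phis mmax mmin) sigc sigs M"
    and stationary: "\<forall>\<^sub>F \<eta> in F. stationary_distribution (P \<eta>) (imbalance (arrc \<eta>) (arrs \<eta>)) (D \<eta>)"
begin

abbreviation lam :: "'i \<Rightarrow> int \<Rightarrow> real" where
  "lam \<eta> \<equiv> controlled_rate a (\<epsilon> \<eta>) (\<tau> \<eta>) phic lmax lmin"

abbreviation mu :: "'i \<Rightarrow> int \<Rightarrow> real" where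
  "mu \<eta> \<equiv> controlled_rate a (\<epsilon> \<eta>) (\<tau> \<eta>) phis mmax mmin"

abbreviation X :: "'i \<Rightarrow> int \<Rightarrow> 'w \<Rightarrow> int" where
  "X \<eta> i w \<equiv> int (arrc \<eta> i 0 w) - int (arrs \<eta> i 0 w)"

lemma queue_walk:
  "\<forall>\<^sub>F \<eta> in F. stationary_walk (P \<eta>) (X \<eta>) (D \<eta>) (2 * M) \<and>
     (\<forall>i. drift (P \<eta>) (X \<eta>) i = lam \<eta> i - mu \<eta> i \<and>
          second_moment (P \<eta>) (X \<eta>) i = sigc (lam \<eta> i) + sigs (mu \<eta> i) + (lam \<eta> i - mu \<eta> i)\<^sup>2)"
  using queue stationary
proof eventually_elim
  case (elim \<eta>)
  interpret matching_queue "P \<eta>" "arrc \<eta>" "arrs \<eta>" "lam \<eta>" "mu \<eta>" sigc sigs M by (rule elim(1))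
  have "step = X \<eta>" by (simp add: fun_eq_iff step_def)
  then show ?case
    using stationary_walk_step[OF elim(2)] drift_step second_moment_step by simp
qed

lemma eps_small:
  assumes "(r :: real) > 0"
  shows "\<forall>\<^sub>F \<eta> in F. \<epsilon> \<eta> * C < r"
proof -
  have "((\<lambda>\<eta>. \<epsilon> \<eta> * C) \<longlongrightarrow> 0 * C) F" by (intro tendsto_intros eps_lim)
  then show ?thesis using assms by (intro order_tendstoD) auto
qed

lemma rate_gap:
  obtains r where "r > 0" "r \<le> lmax - a" "r \<le> a - lmin" "r \<le> mmax - a" "r \<le> a - mmin"
  using that[of "Min {lmax - a, a - lmin, mmax - a, a - mmin}"] rate_gaps by simp

lemma phi_bounded_on_compact:
  obtains B where "B > 0"
    "\<And>t. \<bar>t\<bar> \<le> R \<Longrightarrow> \<bar>phic t\<bar> \<le> B" "\<And>t. \<bar>t\<bar> \<le> R \<Longrightarrow> \<bar>phis t\<bar> \<le> B"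
proof -
  have "compact (phic ` {-R..R} \<union> phis ` {-R..R})"
    by (intro compact_Un compact_continuous_image continuous_on_subset[OF phi_continuous(1)]
        continuous_on_subset[OF phi_continuous(2)]) auto
  then obtain B where B: "B > 0" "\<forall>z \<in> phic ` {-R..R} \<union> phis ` {-R..R}. norm z \<le> B"
    using compact_imp_bounded bounded_pos by metis
  have "\<bar>phic t\<bar> \<le> B" "\<bar>phis t\<bar> \<le> B" if "\<bar>t\<bar> \<le> R" for t
  proof -
    have "t \<in> {-R..R}" using that by auto
    then show "\<bar>phic t\<bar> \<le> B" "\<bar>phis t\<bar> \<le> B" using B(2) by auto
  qed
  with B(1) show ?thesis using that by blast
qed

text \<open>
  On compact sets of the rescaled state the control curves are bounded. As \<open>\<epsilon>\<close> tends to 0,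
  the perturbation of the base rate is eventually smaller than its distance to the clipping levels.
\<close>

lemma rates_unclipped:
  "\<forall>\<^sub>F \<eta> in F. \<forall>i. \<bar>of_int i / \<tau> \<eta>\<bar> \<le> R \<longrightarrow>
     lam \<eta> i = a + \<epsilon> \<eta> * phic (of_int i / \<tau> \<eta>) \<and> mu \<eta> i = a + \<epsilon> \<eta> * phis (of_int i / \<tau> \<eta>)"
proof -
  obtain B where B: "B > 0"
    "\<And>t. \<bar>t\<bar> \<le> R \<Longrightarrow> \<bar>phic t\<bar> \<le> B" "\<And>t. \<bar>t\<bar> \<le> R \<Longrightarrow> \<bar>phis t\<bar> \<le> B"
    using phi_bounded_on_compact[of R] by blast
  obtain r where r: "r > 0" "r \<le> lmax - a" "r \<le> a - lmin" "r \<le> mmax - a" "r \<le> a - mmin"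
    by (rule rate_gap)
  show ?thesis
    using eps_small[OF r(1), of B] eps_pos
  proof eventually_elim
    case (elim \<eta>)
    show ?case
    proof (intro allI impI)
      fix i assume i: "\<bar>of_int i / \<tau> \<eta>\<bar> \<le> R"
      let ?t = "of_int i / \<tau> \<eta>"
      have "\<bar>\<epsilon> \<eta> * phic ?t\<bar> \<le> \<epsilon> \<eta> * B" "\<bar>\<epsilon> \<eta> * phis ?t\<bar> \<le> \<epsilon> \<eta> * B"
        using B(2,3)[OF i] elim(2) by (simp_all add: abs_mult)
      then show "lam \<eta> i = a + \<epsilon> \<eta> * phic ?t \<and> mu \<eta> i = a + \<epsilon> \<eta> * phis ?t"
        using elim(1) r unfolding controlled_rate_def by (intro conjI clip_inactive) linarith+
    qed
  qed
qed

lemma second_moment_local_limit: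
  assumes "e > 0"
  shows "\<forall>\<^sub>F \<eta> in F. \<forall>i. \<bar>of_int i / \<tau> \<eta>\<bar> \<le> R \<longrightarrow>
     \<bar>second_moment (P \<eta>) (X \<eta>) i - (sigc a + sigs a)\<bar> \<le> e"
proof -
  obtain B where B: "B > 0"
    "\<And>t. \<bar>t\<bar> \<le> R \<Longrightarrow> \<bar>phic t\<bar> \<le> B" "\<And>t. \<bar>t\<bar> \<le> R \<Longrightarrow> \<bar>phis t\<bar> \<le> B"
    using phi_bounded_on_compact[of R] by blast
  have e3: "e / 3 > 0" using assms by simp
  obtain r1 where r1: "r1 > 0" "\<And>z. \<bar>z - a\<bar> < r1 \<Longrightarrow> \<bar>sigc z - sigc a\<bar> < e / 3"
    using sig_continuous(1) e3 unfolding continuous_at_eps_delta dist_real_def by blast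
  obtain r2 where r2: "r2 > 0" "\<And>z. \<bar>z - a\<bar> < r2 \<Longrightarrow> \<bar>sigs z - sigs a\<bar> < e / 3"
    using sig_continuous(2) e3 unfolding continuous_at_eps_delta dist_real_def by blast
  define r3 where "r3 = min 1 (e / 3)"
  have r3: "r3 > 0" using e3 by (simp add: r3_def)
  show ?thesis
    using queue_walk rates_unclipped[of R] eps_pos eps_small[OF r1(1), of B] eps_small[OF r2(1), of B]
      eps_small[OF r3, of "2 * B"]
  proof eventually_elim
    case (elim \<eta>)
    show ?case
    proof (intro allI impI)
      fix i assume i: "\<bar>of_int i / \<tau> \<eta>\<bar> \<le> R"
      let ?t = "of_int i / \<tau> \<eta>"
      have b: "\<bar>\<epsilon> \<eta> * phic ?t\<bar> \<le> \<epsilon> \<eta> * B" "\<bar>\<epsilon> \<eta> * phis ?t\<bar> \<le> \<epsilon> \<eta> * B"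
        using B(2,3)[OF i] elim(3) by (simp_all add: abs_mult)
      have rates: "lam \<eta> i = a + \<epsilon> \<eta> * phic ?t" "mu \<eta> i = a + \<epsilon> \<eta> * phis ?t"
        using elim(2) i by blast+
      have "\<bar>sigc (lam \<eta> i) - sigc a\<bar> < e / 3" "\<bar>sigs (mu \<eta> i) - sigs a\<bar> < e / 3"
        using r1(2)[of "lam \<eta> i"] r2(2)[of "mu \<eta> i"] b elim(4,5) unfolding rates by simp_all
      moreover have "(lam \<eta> i - mu \<eta> i)\<^sup>2 \<le> e / 3"
      proof -
        have d: "\<bar>lam \<eta> i - mu \<eta> i\<bar> \<le> r3" unfolding rates using b elim(6) by linarith
        have "\<bar>lam \<eta> i - mu \<eta> i\<bar> * \<bar>lam \<eta> i - mu \<eta> i\<bar> \<le> r3 * 1"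
          using d r3 by (intro mult_mono) (auto simp: r3_def)
        then show ?thesis by (simp add: r3_def power2_eq_square)
      qed
      moreover have "0 \<le> (lam \<eta> i - mu \<eta> i)\<^sup>2" by simp
      moreover have "second_moment (P \<eta>) (X \<eta>) i = sigc (lam \<eta> i) + sigs (mu \<eta> i) + (lam \<eta> i - mu \<eta> i)\<^sup>2"
        using elim(1) by blast
      ultimately show "\<bar>second_moment (P \<eta>) (X \<eta>) i - (sigc a + sigs a)\<bar> \<le> e" by linarith
    qed
  qed
qed

text \<open>
  The rescaled drift is \<open>(\<epsilon> / s) \<psi>(i / \<tau>)\<close> with \<open>\<psi> = phic - phis\<close>,
  and \<open>i / \<tau> = (s i) / (s \<tau>)\<close>. Hence it converges with the two ratios \<open>\<epsilon> / s\<close> and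
  \<open>s \<tau>\<close>, uniformly because \<open>\<psi>\<close> is uniformly continuous on compact sets.
\<close>

lemma drift_local_limit:
  assumes s: "\<forall>\<^sub>F \<eta> in F. s \<eta> > 0" and x: "((\<lambda>\<eta>. \<epsilon> \<eta> / s \<eta>) \<longlongrightarrow> x) F" "x > 0"
    and y: "((\<lambda>\<eta>. s \<eta> * \<tau> \<eta>) \<longlongrightarrow> y) F" "y > 0" and e: "e > 0"
  shows "\<forall>\<^sub>F \<eta> in F. \<forall>i. \<bar>s \<eta> * of_int i\<bar> \<le> R \<longrightarrow> \<bar>of_int i / \<tau> \<eta>\<bar> \<le> 2 * \<bar>R\<bar> / y \<and>
     \<bar>drift (P \<eta>) (X \<eta>) i / s \<eta> - x * (phic (s \<eta> * of_int i / y) - phis (s \<eta> * of_int i / y))\<bar> \<le> e"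
proof -
  have y0: "y \<noteq> 0" using y(2) by simp
  \<comment> \<open>Eventually \<open>s \<tau> > y / 2\<close>, so \<open>\<bar>s i\<bar> \<le> R\<close> keeps both arguments of \<open>\<psi>\<close> in \<open>[- R', R']\<close>.\<close>
  define R' where "R' = 2 * \<bar>R\<bar> / y"
  define \<psi> where "\<psi> t = phic t - phis t" for t
  have c\<psi>: "continuous_on {-R'..R'} \<psi>"
    unfolding \<psi>_def[abs_def]
    by (intro continuous_on_diff continuous_on_subset[OF phi_continuous(1)]
        continuous_on_subset[OF phi_continuous(2)]) auto
  obtain B where B: "B > 0"
    "\<And>t. \<bar>t\<bar> \<le> R' \<Longrightarrow> \<bar>phic t\<bar> \<le> B" "\<And>t. \<bar>t\<bar> \<le> R' \<Longrightarrow> \<bar>phis t\<bar> \<le> B"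
    using phi_bounded_on_compact[of R'] by blast
  have "e / (2 * x) > 0" using e x by simp
  then obtain C where C: "C \<ge> 0"
    "\<And>p q. \<lbrakk>\<bar>p\<bar> \<le> R'; \<bar>q\<bar> \<le> R'\<rbrakk> \<Longrightarrow> \<bar>\<psi> p - \<psi> q\<bar> \<le> e / (2 * x) + C * \<bar>p - q\<bar>"
    using continuous_almost_lipschitz_on_compact[OF c\<psi>] by blast
  let ?err = "\<lambda>\<eta>. \<bar>\<epsilon> \<eta> / s \<eta> - x\<bar> * (2 * B) + x * (e / (2 * x) + C * (\<bar>R\<bar> * \<bar>1 / (s \<eta> * \<tau> \<eta>) - 1 / y\<bar>))"
  have "(?err \<longlongrightarrow> \<bar>x - x\<bar> * (2 * B) + x * (e / (2 * x) + C * (\<bar>R\<bar> * \<bar>1 / y - 1 / y\<bar>))) F"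
    by (intro tendsto_intros x y y0)
  then have "\<forall>\<^sub>F \<eta> in F. ?err \<eta> < e"
    by (rule order_tendstoD) (use x e in simp)
  moreover have "\<forall>\<^sub>F \<eta> in F. y / 2 < s \<eta> * \<tau> \<eta>"
    using y by (intro order_tendstoD) auto
  ultimately show ?thesis
    using s tau_pos queue_walk rates_unclipped[of R']
  proof eventually_elim
    case (elim \<eta>)
    show ?case
    proof (intro allI impI)
      fix i assume i: "\<bar>s \<eta> * of_int i\<bar> \<le> R"
      let ?y = "s \<eta> * of_int i" and ?t = "of_int i / \<tau> \<eta>"
      have R: "\<bar>R\<bar> = R" using i by simp
      have t: "?t = ?y / (s \<eta> * \<tau> \<eta>)" using elim(3) by simp
      have "\<bar>?t\<bar> = \<bar>?y\<bar> / (s \<eta> * \<tau> \<eta>)" unfolding t using elim(3,4) by (simp add: abs_mult)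
      also have "\<dots> \<le> R / (y / 2)" using i elim(2) y(2) R by (intro frac_le) auto
      finally have tR: "\<bar>?t\<bar> \<le> R'" using R by (simp add: R'_def field_simps)
      have "\<bar>?y / y\<bar> \<le> R / y" unfolding abs_divide using i y(2) by (simp add: divide_right_mono)
      also have "\<dots> \<le> R'" using R y(2) by (simp add: R'_def divide_right_mono)
      finally have yR: "\<bar>?y / y\<bar> \<le> R'" .
      have "lam \<eta> i = a + \<epsilon> \<eta> * phic ?t" "mu \<eta> i = a + \<epsilon> \<eta> * phis ?t"
        using elim(6) tR by blast+
      then have dr: "drift (P \<eta>) (X \<eta>) i = \<epsilon> \<eta> * \<psi> ?t"
        using elim(5)[THEN conjunct2, rule_format, of i, THEN conjunct1]
        by (simp only: \<psi>_def right_diff_distrib)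
      have "drift (P \<eta>) (X \<eta>) i / s \<eta> - x * \<psi> (?y / y)
          = (\<epsilon> \<eta> / s \<eta> - x) * \<psi> ?t + x * (\<psi> ?t - \<psi> (?y / y))"
        unfolding dr by (simp add: algebra_simps)
      also have "\<bar>\<dots>\<bar> \<le> \<bar>\<epsilon> \<eta> / s \<eta> - x\<bar> * \<bar>\<psi> ?t\<bar> + x * \<bar>\<psi> ?t - \<psi> (?y / y)\<bar>"
        using x(2) by (metis abs_mult abs_of_pos abs_triangle_ineq)
      also have "\<dots> \<le> ?err \<eta>"
      proof -
        have "\<bar>\<psi> ?t\<bar> \<le> 2 * B" using B(2,3)[OF tR] by (simp add: \<psi>_def)
        moreover have "\<bar>?t - ?y / y\<bar> \<le> \<bar>R\<bar> * \<bar>1 / (s \<eta> * \<tau> \<eta>) - 1 / y\<bar>"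
        proof -
          have "?t - ?y / y = ?y * (1 / (s \<eta> * \<tau> \<eta>) - 1 / y)" unfolding t by (simp add: algebra_simps)
          then show ?thesis using i unfolding R by (simp only: abs_mult) (rule mult_right_mono, auto)
        qed
        then have "\<bar>\<psi> ?t - \<psi> (?y / y)\<bar> \<le> e / (2 * x) + C * (\<bar>R\<bar> * \<bar>1 / (s \<eta> * \<tau> \<eta>) - 1 / y\<bar>)"
          using C(2)[OF tR yR] mult_left_mono[OF _ C(1)] by (meson add_left_mono order_trans)
        ultimately show ?thesis using x(2) by (intro add_mono mult_left_mono) auto
      qed
      also have "\<dots> \<le> e" using elim(1) by simp
      finally show "\<bar>?t\<bar> \<le> 2 * \<bar>R\<bar> / y \<and>
          \<bar>drift (P \<eta>) (X \<eta>) i / s \<eta> - x * (phic (?y / y) - phis (?y / y))\<bar> \<le> e"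
        using tR by (simp add: R'_def \<psi>_def)
    qed
  qed
qed

lemma restoring_drift:
  obtains \<delta> K where "\<delta> > 0" "K > 0"
    "\<And>t. t > K \<Longrightarrow> phic t - phis t < - \<delta>" "\<And>t. t < - K \<Longrightarrow> phic t - phis t > \<delta>"
    "\<forall>\<^sub>F \<eta> in F. \<forall>i.
       (of_int i / \<tau> \<eta> > K \<longrightarrow> drift (P \<eta>) (X \<eta>) i \<le> - (\<epsilon> \<eta> * \<delta>)) \<and>
       (of_int i / \<tau> \<eta> < - K \<longrightarrow> drift (P \<eta>) (X \<eta>) i \<ge> \<epsilon> \<eta> * \<delta>)"
proof -
  obtain \<delta> K B where c: "\<delta> > 0" "K > 0" "B > 0"
    and right: "\<And>t. t > K \<Longrightarrow> phic t - phis t < - \<delta> \<and> max (phic t) 0 + max (- phis t) 0 \<le> B"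
    and left: "\<And>t. t < - K \<Longrightarrow> phic t - phis t > \<delta> \<and> max (- phic t) 0 + max (phis t) 0 \<le> B"
    using confining unfolding negative_drift_def by blast
  obtain r where r: "r > 0" "r \<le> lmax - a" "r \<le> a - lmin" "r \<le> mmax - a" "r \<le> a - mmin"
    by (rule rate_gap)
  have "\<forall>\<^sub>F \<eta> in F. \<forall>i.
       (of_int i / \<tau> \<eta> > K \<longrightarrow> drift (P \<eta>) (X \<eta>) i \<le> - (\<epsilon> \<eta> * \<delta>)) \<and>
       (of_int i / \<tau> \<eta> < - K \<longrightarrow> drift (P \<eta>) (X \<eta>) i \<ge> \<epsilon> \<eta> * \<delta>)"
    using queue_walk eps_pos eps_small[OF r(1), of "B + \<delta>"]
  proof eventually_elim
    case (elim \<eta>)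
    have pos: "0 \<le> \<epsilon> \<eta> * \<delta>" "0 \<le> \<epsilon> \<eta> * B" using elim(2) c by simp_all
    have gap: "\<epsilon> \<eta> * B + \<epsilon> \<eta> * \<delta> \<le> r" using elim(3) by (simp add: algebra_simps)
    show ?case
    proof (intro allI conjI impI)
      fix i assume i: "of_int i / \<tau> \<eta> > K"
      let ?t = "of_int i / \<tau> \<eta>"
      have "phic ?t - phis ?t \<le> - \<delta>" "phic ?t \<le> B" "- phis ?t \<le> B" using right[OF i] by linarith+
      note mult_left_mono[OF this(1), of "\<epsilon> \<eta>"] mult_left_mono[OF this(2), of "\<epsilon> \<eta>"]
        mult_left_mono[OF this(3), of "\<epsilon> \<eta>"]
      then show "drift (P \<eta>) (X \<eta>) i \<le> - (\<epsilon> \<eta> * \<delta>)"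
        using elim(1,2) pos gap r unfolding controlled_rate_def
        by (simp, intro clipped_drift_le[where b = "\<epsilon> \<eta> * B"]) (auto simp: algebra_simps)
    next
      fix i assume i: "of_int i / \<tau> \<eta> < - K"
      let ?t = "of_int i / \<tau> \<eta>"
      have "phis ?t - phic ?t \<le> - \<delta>" "phis ?t \<le> B" "- phic ?t \<le> B" using left[OF i] by linarith+
      note mult_left_mono[OF this(1), of "\<epsilon> \<eta>"] mult_left_mono[OF this(2), of "\<epsilon> \<eta>"]
        mult_left_mono[OF this(3), of "\<epsilon> \<eta>"]
      then have "mu \<eta> i - lam \<eta> i \<le> - (\<epsilon> \<eta> * \<delta>)"
        using elim(2) pos gap r unfolding controlled_rate_def
        by (intro clipped_drift_le[where b = "\<epsilon> \<eta> * B"]) (auto simp: algebra_simps)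
      then show "drift (P \<eta>) (X \<eta>) i \<ge> \<epsilon> \<eta> * \<delta>" using elim(1) by simp
    qed
  qed
  with c right left show ?thesis using that by blast
qed

text \<open>
  The scale \<open>s\<close> is arbitrary up to the two limits that determine the parameters of the
  Gibbs law. Its choices \<open>\<epsilon>\<close> and \<open>1 / \<tau>\<close> give the two normalisations of the imbalance at
  once.
\<close>

theorem scaled_imbalance_limit:
  assumes s: "\<forall>\<^sub>F \<eta> in F. s \<eta> > 0" "(s \<longlongrightarrow> 0) F"
    and x: "((\<lambda>\<eta>. \<epsilon> \<eta> / s \<eta>) \<longlongrightarrow> x) F" "x > 0"
    and y: "((\<lambda>\<eta>. s \<eta> * \<tau> \<eta>) \<longlongrightarrow> y) F" "y > 0"
  defines "g \<equiv> gibbs_drift (sigc a + sigs a) phic phis x y"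
  shows "gibbs_normalizable g"
    and "weak_conv_along F (\<lambda>\<eta>. distr (D \<eta>) borel (\<lambda>i. s \<eta> * of_int i)) (Gibbs g)"
proof -
  let ?v = "sigc a + sigs a"
  obtain \<delta> K where c: "\<delta> > 0" "K > 0"
    and right: "\<And>t. t > K \<Longrightarrow> phic t - phis t < - \<delta>"
    and left: "\<And>t. t < - K \<Longrightarrow> phic t - phis t > \<delta>"
    and restoring: "\<forall>\<^sub>F \<eta> in F. \<forall>i.
       (of_int i / \<tau> \<eta> > K \<longrightarrow> drift (P \<eta>) (X \<eta>) i \<le> - (\<epsilon> \<eta> * \<delta>)) \<and>
       (of_int i / \<tau> \<eta> < - K \<longrightarrow> drift (P \<eta>) (X \<eta>) i \<ge> \<epsilon> \<eta> * \<delta>)"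
    using restoring_drift by blast
  have g: "?v / 2 * g t = - (x * (phic (t / y) - phis (t / y)))" for t
    using variance_pos by (simp add: g_def gibbs_drift_def field_simps)
  \<comment> \<open>The first term bounds the prelimit drift, as eventually \<open>\<epsilon> / s > x / 2\<close>; the second one bounds \<open>g\<close>. Beyond \<open>2 K y\<close> the argument \<open>i / \<tau>\<close> exceeds \<open>K\<close> once \<open>s \<tau> < 2 y\<close>.\<close>
  define c where "c = min (x * \<delta> / 2) (2 * x * \<delta> / ?v)"
  interpret gibbs_scaling F P X D s "2 * M" ?v c "2 * K * y" g
  proof unfold_locales
    show "\<forall>\<^sub>F \<eta> in F. stationary_walk (P \<eta>) (X \<eta>) (D \<eta>) (2 * M)"
      using queue_walk by (rule eventually_mono) blast
    show "c > 0" using x c variance_pos by (simp add: c_def)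
    show "continuous_on UNIV g"
      unfolding g_def gibbs_drift_def[abs_def] using y(2)
      by (intro continuous_intros continuous_on_compose2[OF phi_continuous(1)]
          continuous_on_compose2[OF phi_continuous(2)]) auto
    have Ky: "0 < K * y" using c(2) y(2) by simp
    show "g t \<ge> c" if "t > 2 * K * y" for t
    proof -
      have "K * y < t" using that Ky by linarith
      then have "K < t / y" using y(2) by (simp add: pos_less_divide_eq)
      then have "\<delta> \<le> - (phic (t / y) - phis (t / y))" using right by fastforce
      then have "x * \<delta> \<le> x * - (phic (t / y) - phis (t / y))" using x(2) by (intro mult_left_mono) auto
      also have "\<dots> = ?v / 2 * g t" unfolding g by (rule mult_minus_right)
      finally have "2 * x * \<delta> / ?v \<le> g t"
        unfolding pos_divide_le_eq[OF variance_pos] by (simp add: algebra_simps)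
      then show ?thesis by (simp add: c_def)
    qed
    show "g t \<le> - c" if "t < - (2 * K * y)" for t
    proof -
      have "t < - K * y" using that Ky by linarith
      then have "t / y < - K" using y(2) by (simp add: pos_divide_less_eq)
      then have "\<delta> \<le> phic (t / y) - phis (t / y)" using left by fastforce
      then have "x * \<delta> \<le> x * (phic (t / y) - phis (t / y))" using x(2) by (intro mult_left_mono) auto
      also have "\<dots> = ?v / 2 * - g t" using g[of t] by linarith
      finally have "2 * x * \<delta> / ?v \<le> - g t"
        unfolding pos_divide_le_eq[OF variance_pos] by (simp add: algebra_simps)
      then show ?thesis by (simp add: c_def)
    qed
    show "\<forall>\<^sub>F \<eta> in F. \<forall>i. \<bar>s \<eta> * of_int i\<bar> \<le> R \<longrightarrow>
        \<bar>drift (P \<eta>) (X \<eta>) i / s \<eta> + ?v / 2 * g (s \<eta> * of_int i)\<bar> \<le> e \<and>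
        \<bar>second_moment (P \<eta>) (X \<eta>) i - ?v\<bar> \<le> e" if "e > 0" for R e
      using drift_local_limit[OF s(1) x y that, of R]
        second_moment_local_limit[OF that, of "2 * \<bar>R\<bar> / y"]
      unfolding g by eventually_elim simp
    have "\<forall>\<^sub>F \<eta> in F. x / 2 < \<epsilon> \<eta> / s \<eta>" using x by (intro order_tendstoD) auto
    moreover have "\<forall>\<^sub>F \<eta> in F. s \<eta> * \<tau> \<eta> < 2 * y" using y by (intro order_tendstoD) auto
    ultimately show "\<forall>\<^sub>F \<eta> in F. \<forall>i.
        (s \<eta> * of_int i > 2 * K * y \<longrightarrow> drift (P \<eta>) (X \<eta>) i / s \<eta> \<le> - c) \<and>
        (s \<eta> * of_int i < - (2 * K * y) \<longrightarrow> drift (P \<eta>) (X \<eta>) i / s \<eta> \<ge> c)"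
      using restoring s(1) tau_pos
    proof eventually_elim
      case (elim \<eta>)
      have "c \<le> x / 2 * \<delta>" by (simp add: c_def)
      also have "\<dots> \<le> \<epsilon> \<eta> / s \<eta> * \<delta>" using elim(1) c by (intro mult_right_mono) auto
      finally have rate: "c \<le> \<epsilon> \<eta> * \<delta> / s \<eta>" by simp
      have far: "K * (s \<eta> * \<tau> \<eta>) \<le> 2 * K * y" 
        using mult_left_mono[OF less_imp_le[OF elim(2)], of K] c(2) by simp
      show ?case
      proof (intro allI conjI impI)
        fix i assume "s \<eta> * of_int i > 2 * K * y"
        then have "s \<eta> * (K * \<tau> \<eta>) < s \<eta> * of_int i" using far by (simp add: mult_ac)
        then have "of_int i / \<tau> \<eta> > K" using elim(4,5) by (simp add: pos_less_divide_eq)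
        then have "drift (P \<eta>) (X \<eta>) i / s \<eta> \<le> - (\<epsilon> \<eta> * \<delta>) / s \<eta>"
          using elim(3,4) by (intro divide_right_mono) auto
        then show "drift (P \<eta>) (X \<eta>) i / s \<eta> \<le> - c" using rate by simp
      next
        fix i assume "s \<eta> * of_int i < - (2 * K * y)"
        then have "s \<eta> * of_int i < s \<eta> * (- K * \<tau> \<eta>)" using far by (simp add: mult_ac)
        then have "of_int i < - K * \<tau> \<eta>" using elim(4) by (simp only: mult_less_cancel_left_pos)
        then have "of_int i / \<tau> \<eta> < - K" using elim(5) by (simp add: pos_divide_less_eq)
        then have "\<epsilon> \<eta> * \<delta> / s \<eta> \<le> drift (P \<eta>) (X \<eta>) i / s \<eta>"
          using elim(3,4) by (intro divide_right_mono) auto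
        then show "drift (P \<eta>) (X \<eta>) i / s \<eta> \<ge> c" using rate by simp
      qed
    qed
  qed (use s M_nonneg variance_pos c y in auto)
  show "gibbs_normalizable g" by (rule normalizable)
  show "weak_conv_along F (\<lambda>\<eta>. distr (D \<eta>) borel (\<lambda>i. s \<eta> * of_int i)) (Gibbs g)"
    by (rule scaled_stationary_weak_limit)
qed

end

section \<open>Convergence of the scaled imbalance\<close>

theorem theorem1:
  fixes lmax lmin mmax mmin smax M lstar mstar l \<eta>p :: real
    and sigc sigs phic phis :: "real \<Rightarrow> real"
    and \<epsilon> \<tau> lstar_at :: "real \<Rightarrow> real"
    and P :: "real \<Rightarrow> 'w measure"
    and arrc arrs :: "real \<Rightarrow> int \<Rightarrow> nat \<Rightarrow> 'w \<Rightarrow> nat"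
    and Q :: "real \<Rightarrow> 'v measure"
    and zbar :: "real \<Rightarrow> 'v \<Rightarrow> int"
  assumes "lmin \<ge> 0" "lmax \<ge> lmin" "mmin \<ge> 0" "mmax \<ge> mmin" "smax > 0" "M > 0"
    and "lmin < mstar" "mstar < lmax" "mmin < mstar" "mstar < mmax"
    and "continuous_on UNIV sigc" "continuous_on UNIV sigs"
    and "\<forall>x. 0 \<le> sigc x \<and> sigc x \<le> smax" "\<forall>x. 0 \<le> sigs x \<and> sigs x \<le> smax"
    and "phic \<in> borel_measurable borel" "phis \<in> borel_measurable borel"
    and "\<forall>\<eta>>0. \<epsilon> \<eta> > 0" "\<forall>\<eta>>0. \<tau> \<eta> > 0"
    and "\<forall>\<eta>>0. matching_queue (P \<eta>) (arrc \<eta>) (arrs \<eta>)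
           (controlled_rate (lstar_at \<eta>) (\<epsilon> \<eta>) (\<tau> \<eta>) phic lmax lmin)
           (controlled_rate mstar (\<epsilon> \<eta>) (\<tau> \<eta>) phis mmax mmin)
           sigc sigs M"
    and "(\<epsilon> \<longlongrightarrow> 0) at_top \<or> filterlim \<tau> at_top at_top"
    and "l > 0" "((\<lambda>\<eta>. \<epsilon> \<eta> * \<tau> \<eta>) \<longlongrightarrow> l) at_top"
    and "\<forall>\<eta>>0. lstar_at \<eta> = lstar" "lstar = mstar"
    and "sigc lstar + sigs mstar > 0"
    and "negative_drift phic phis"
    and "subquadratic_growth phic phis"
    and "infinitely_differentiable phic" "infinitely_differentiable phis"
    and "\<eta>p > 0"
    and "\<forall>\<eta>>\<eta>p. positive_recurrent_chain (P \<eta>) (imbalance (arrc \<eta>) (arrs \<eta>))"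
    and "\<forall>\<eta>>\<eta>p. prob_space (Q \<eta>) \<and> zbar \<eta> \<in> measurable (Q \<eta>) (count_space UNIV) \<and>
           stationary_distribution (P \<eta>) (imbalance (arrc \<eta>) (arrs \<eta>))
             (distr (Q \<eta>) (count_space UNIV) (zbar \<eta>))"
  shows "(gibbs_normalizable (gibbs_drift (sigc lstar + sigs mstar) phic phis 1 l) \<and>
          weak_conv_along at_top
            (\<lambda>\<eta>. distr (Q \<eta>) borel (\<lambda>w. \<epsilon> \<eta> * real_of_int (zbar \<eta> w)))
            (Gibbs (gibbs_drift (sigc lstar + sigs mstar) phic phis 1 l))) \<and>
         (gibbs_normalizable (gibbs_drift (sigc lstar + sigs mstar) phic phis l 1) \<and>
          weak_conv_along at_top
            (\<lambda>\<eta>. distr (Q \<eta>) borel (\<lambda>w. real_of_int (zbar \<eta> w) / \<tau> \<eta>))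
            (Gibbs (gibbs_drift (sigc lstar + sigs mstar) phic phis l 1)))"
proof -
  have pos: "\<forall>\<^sub>F \<eta> in at_top. (\<eta>::real) > 0" and rec: "\<forall>\<^sub>F \<eta> in at_top. \<eta> > \<eta>p"
    by (rule eventually_gt_at_top)+
  have eps_pos: "\<forall>\<^sub>F \<eta> in at_top. \<epsilon> \<eta> > 0" and tau_pos: "\<forall>\<^sub>F \<eta> in at_top. \<tau> \<eta> > 0"
    using pos by (rule eventually_mono, use assms(17,18) in blast)+
  have eps_lim: "(\<epsilon> \<longlongrightarrow> 0) at_top"
    using assms(20)
  proof
    assume "filterlim \<tau> at_top at_top"
    then have "((\<lambda>\<eta>. \<epsilon> \<eta> * \<tau> \<eta> * inverse (\<tau> \<eta>)) \<longlongrightarrow> l * 0) at_top"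
      by (intro tendsto_mult assms(22) tendsto_inverse_0_at_top)
    moreover have "\<forall>\<^sub>F \<eta> in at_top. \<epsilon> \<eta> * \<tau> \<eta> * inverse (\<tau> \<eta>) = \<epsilon> \<eta>"
      using tau_pos by eventually_elim simp
    ultimately show ?thesis by (simp add: tendsto_cong)
  qed
  have tau_lim: "((\<lambda>\<eta>. 1 / \<tau> \<eta>) \<longlongrightarrow> 0) at_top"
  proof -
    have "((\<lambda>\<eta>. \<epsilon> \<eta> / (\<epsilon> \<eta> * \<tau> \<eta>)) \<longlongrightarrow> 0 / l) at_top"
      using assms(21) by (intro tendsto_divide eps_lim assms(22)) simp
    moreover have "\<forall>\<^sub>F \<eta> in at_top. \<epsilon> \<eta> / (\<epsilon> \<eta> * \<tau> \<eta>) = 1 / \<tau> \<eta>"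
      using eps_pos by eventually_elim simp
    ultimately show ?thesis by (simp add: tendsto_cong)
  qed
  define D where "D \<eta> = distr (Q \<eta>) (count_space UNIV) (zbar \<eta>)" for \<eta>
  interpret queue_family at_top lmax lmin mmax mmin M mstar sigc sigs phic phis \<epsilon> \<tau> P arrc arrs D
  proof unfold_locales
    show "isCont sigc mstar" "isCont sigs mstar"
      using assms(11,12) by (auto simp: continuous_on_eq_continuous_at)
    show "continuous_on UNIV phic" "continuous_on UNIV phis"
      using assms(28,29)[unfolded infinitely_differentiable_def, rule_format, of 0]
      by (auto intro: differentiable_imp_continuous_on)
    show "\<forall>\<^sub>F \<eta> in at_top. matching_queue (P \<eta>) (arrc \<eta>) (arrs \<eta>)
           (controlled_rate mstar (\<epsilon> \<eta>) (\<tau> \<eta>) phic lmax lmin)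
           (controlled_rate mstar (\<epsilon> \<eta>) (\<tau> \<eta>) phis mmax mmin) sigc sigs M"
      using pos by (rule eventually_mono) (use assms(19,23,24) in simp)
    show "\<forall>\<^sub>F \<eta> in at_top. stationary_distribution (P \<eta>) (imbalance (arrc \<eta>) (arrs \<eta>)) (D \<eta>)"
      using rec by (rule eventually_mono) (use assms(32) in \<open>simp add: D_def\<close>)
  qed (use assms(6-10,24-26) eps_pos tau_pos eps_lim in auto)
  have law: "\<forall>\<^sub>F \<eta> in at_top. distr (D \<eta>) borel (\<lambda>i. s \<eta> * of_int i)
      = distr (Q \<eta>) borel (\<lambda>w. s \<eta> * real_of_int (zbar \<eta> w))" for s
    using rec
  proof eventually_elim
    case (elim \<eta>)
    then show ?case
      unfolding D_def by (subst distr_distr) (use assms(32) in \<open>auto simp: comp_def\<close>)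
  qed
  have "((\<lambda>\<eta>. \<epsilon> \<eta> / \<epsilon> \<eta>) \<longlongrightarrow> 1) at_top"
    by (rule tendsto_eventually) (use eps_pos in \<open>auto elim: eventually_mono\<close>)
  note limit_eps = scaled_imbalance_limit[OF eps_pos eps_lim this _ assms(22,21)]
  have inv_pos: "\<forall>\<^sub>F \<eta> in at_top. 1 / \<tau> \<eta> > 0"
    using tau_pos by eventually_elim simp
  have tau_ratio: "((\<lambda>\<eta>. \<epsilon> \<eta> / (1 / \<tau> \<eta>)) \<longlongrightarrow> l) at_top" using assms(22) by simp
  have tau_product: "((\<lambda>\<eta>. 1 / \<tau> \<eta> * \<tau> \<eta>) \<longlongrightarrow> 1) at_top"
    by (rule tendsto_eventually) (use tau_pos in \<open>auto elim: eventually_mono\<close>)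
  note limit_tau = scaled_imbalance_limit[OF inv_pos tau_lim tau_ratio assms(21) tau_product zero_less_one]
  show ?thesis
    using limit_eps limit_tau
    unfolding weak_conv_along_cong[OF law] assms(24) by simp
qed

end
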